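(* Assume that $m(\beta)=\beta$, $h_{n,\alpha_n}=h_02^{-\alpha_n}$, and that there are constants $C_{\mathrm{work}},C_{\mathrm{error}}>0$ and rates $\widetilde\gamma_n,\widetilde r_n>0$ ($n=1,\dots,D$), $\widetilde g_n>0$ ($n=1,\dots,N$) such that the mixed work and error contributions satisfy, for all $(\boldsymbol\alpha,\boldsymbol\beta)\in\mathbb{N}_+^{D+N}$, $$\Delta W_{\boldsymbol\alpha,\boldsymbol\beta}\le C_{\mathrm{work}}\Big(\prod_{n=1}^D2^{\alpha_n\widetilde\gamma_n}\Big)\Big(\prod_{n=1}^N(\beta_n+1)\Big),\qquad \Delta E_{\boldsymbol\alpha,\boldsymbol\beta}\le C_{\mathrm{error}}\Big(\prod_{n=1}^D2^{-\alpha_n\widetilde r_n}\Big)\Big(\prod_{n=1}^Ne^{-\widetilde g_n(\beta_n+1)}\Big)$$ (together with the corresponding bounds for the purely deterministic and purely stochastic contributions). Let $r_j=\log(2)\widetilde r_j$, $\gamma_j=\log(2)\widetilde\gamma_j$, $j=1,\dots,D$, $\mathbf{\Theta}=\big(\frac{\gamma_1}{r_1+\gamma_1},\dots,\frac{\gamma_D}{r_D+\gamma_D}\big)$, $\mu=\min_n\frac{r_n}{\gamma_n}$, $\chi=\max_n\mathbf{\Theta}_n$, and $n(\mathbf{\Theta},\chi)=\#\{n:\mathbf{\Theta}_n=\chi\}$. For $L\in\mathbb{R}$ let $$\mathcal{I}(L)=\Big\{(\boldsymbol\alpha,\boldsymbol\beta)\in\mathbb{N}_+^{D+N}:\ \sum_{n=1}^D(r_n+\gamma_n)\alpha_n+\sum_{n=1}^N\widetilde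 g_n(\beta_n+1)+\sum_{n=1}^N\log(\beta_n+1)\le L\Big\}.$$ Then there exists a constant $C_W>0$ such that for any $W_{\max}$ satisfying $W_{\max}\ge C_We^{\chi}$, setting $$L=L(W_{\max})=\frac1\chi\left(\log\Big(\frac{W_{\max}}{C_W}\Big)-(n(\mathbf{\Theta},\chi)-1)\log\Big(\frac1\chi\log\Big(\frac{W_{\max}}{C_W}\Big)\Big)\right),$$ the combination technique solution $\mathcal{M}_{\mathcal{I}(L)}(u)=\sum_{(\boldsymbol\alpha,\boldsymbol\beta)\in\mathcal{I}(L)}\boldsymbol\Delta[u^{\boldsymbol\alpha,\boldsymbol\beta}]$ satisfies $$\mathrm{Work}\big[\mathcal{M}_{\mathcal{I}(L(W_{\max}))}(u)\big]\le W_{\max},$$ $$\limsup_{W_{\max}\to\infty}\frac{\mathrm{Error}\big[\mathcal{M}_{\mathcal{I}(L(W_{\max}))}(u)\big]}{W_{\max}^{-\mu}\,\big(\log W_{\max}\big)^{(\mu+1)(n(\mathbf{\Theta},\chi)-1)}}=C<\infty.$$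
   Context: Notation: $\mathbb{N}_+=\{1,2,\dots\}$; $N\ge1$ is the number of random parameters, $D\ge1$ the number of spatial discretization parameters. Optimal control problem. $\boldsymbol\zeta=(\zeta_1,\dots,\zeta_N)$ is a random vector with independent components uniformly distributed on $\Gamma=\Gamma_1\times\dots\times\Gamma_N$ (compact), with density $\rho=\prod_n\rho_n$, $\rho_n=1/|\Gamma_n|$. $U,V$ are separable Hilbert spaces, $B:U\to V'$ is linear bounded, $\phi$ is a given source in $V'$, $\nu>0$, $e(\cdot,\cdot):V\times\Gamma\to V'$ represents a random PDE. The state equation $\langle e(y(\boldsymbol\zeta),\boldsymbol\zeta),v\rangle=\langle\phi+Bu,v\rangle$ for all $v\in V$, $\rho$-a.e. $\boldsymbol\zeta$, is assumed well-posed, with solution $y\in L^p_\rho(\Gamma;V)$ for some $p\ge1$ and Gateaux differentiable solution operator $S_{\boldsymbol\zeta}:U\to V$, $y(\boldsymbol\zeta)=S_{\boldsymbol\zeta}(u)$. $F:L^p_\rho(\Gamma;V)\to L^q_\rho(\Gamma;\mathbb{R})$, $q\ge1$, is convex and Fréchet differentiable. The problem is to minimize $J(u)=\mathbb{E}[F(S_{\boldsymbol\zeta}(u))]+\frac{\nu}{2}\|u\|_U^2$ over $u\in U$. It is assumed that it admits a solution $u\in U$ satisfying $\langle J'(u),v\rangle=\langle\nu u-B^\star\mathbb{E}[p],v\rangle=0$ for all $v\in U$, where the adjoint variable $p$ solves $\langle e^\star(p(\boldsymbol\zeta),\boldsymbol\zeta),v\rangle=\langle F'(y(\boldsymbol\zeta)),v\rangle$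 for all $v\in V$, $\rho$-a.e. $\boldsymbol\zeta$ ($e^\star$ the adjoint operator of $e$), and that $J$ is twice Fréchet differentiable with Hessian at $u$ positive definite, with bounded inverse, and locally Lipschitz near $u$. Discretization. For $\boldsymbol\beta\in\mathbb{N}_+^N$, $\mathbb{E}^{\boldsymbol\beta}$ is the tensor product quadrature $\mathcal{Q}_1^{\beta_1}\otimes\cdots\otimes\mathcal{Q}_N^{\beta_N}$ of one-dimensional quadrature rules $\mathcal{Q}_j^{\beta_j}$ with $m(\beta_j)$ nodes approximating integration against $\rho_j(\zeta_j)\,d\zeta_j$; $\Lambda_{\boldsymbol\beta}\subset\Gamma$ is its set of nodes. For $\boldsymbol\alpha\in\mathbb{N}_+^D$, $U^{\boldsymbol\alpha}$, $V^{\boldsymbol\alpha}$ are finite-dimensional approximations of $U,V$ associated with mesh sizes $h_{n,\alpha_n}$ ($n=1,\dots,D$). $u^{\boldsymbol\alpha,\boldsymbol\beta}$ is a solution of: minimize $\mathbb{E}^{\boldsymbol\beta}[F(y(\boldsymbol\zeta))]+\frac{\nu}{2}\|u\|_U^2$ over $u\in U^{\boldsymbol\alpha}$, where $y(\boldsymbol\zeta)\in V^{\boldsymbol\alpha}$ solves $\langle e(y(\boldsymbol\zeta),\boldsymbol\zeta),v\rangle=\langle\phi+Bu,v\rangle$ for all $v\in V^{\boldsymbol\alpha}$ and all $\boldsymbol\zeta\in\Lambda_{\boldsymbol\beta}$. Hierarchical surpluses (with $|\mathbf j|=\sum_ij_i$ and the convention $u^{\boldsymbol\alpha,\boldsymbol\beta}=0$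 if any component of $\boldsymbol\alpha$ or $\boldsymbol\beta$ is zero): deterministic $\Delta^{\mathrm{det}}[u^{\boldsymbol\alpha,\boldsymbol\beta}]=\sum_{\mathbf j\in\{0,1\}^D}(-1)^{|\mathbf j|}u^{\boldsymbol\alpha-\mathbf j,\boldsymbol\beta}$; stochastic $\Delta^{\mathrm{stoc}}[u^{\boldsymbol\alpha,\boldsymbol\beta}]=\sum_{\mathbf j\in\{0,1\}^N}(-1)^{|\mathbf j|}u^{\boldsymbol\alpha,\boldsymbol\beta-\mathbf j}$; mixed $\boldsymbol\Delta[u^{\boldsymbol\alpha,\boldsymbol\beta}]=\Delta^{\mathrm{stoc}}[\Delta^{\mathrm{det}}[u^{\boldsymbol\alpha,\boldsymbol\beta}]]$. Standing assumption: $u^{\boldsymbol\alpha,\boldsymbol\beta}\to u$ in $U$ as $(\boldsymbol\alpha,\boldsymbol\beta)\to\infty$ componentwise, and $\{\|\boldsymbol\Delta[u^{\boldsymbol\alpha,\boldsymbol\beta}]\|_U\}\in\ell^1(\mathbb{N}_+^{D+N})$, so $u=\sum_{(\boldsymbol\alpha,\boldsymbol\beta)\in\mathbb{N}_+^{D+N}}\boldsymbol\Delta[u^{\boldsymbol\alpha,\boldsymbol\beta}]$ with absolute convergence. Work and error. $\mathrm{Work}[\cdot]\ge0$ denotes computational cost. The work contribution $\Delta W_{\boldsymbol\alpha,\boldsymbol\beta}\ge0$ is the cost of computing $\boldsymbol\Delta[u^{\boldsymbol\alpha,\boldsymbol\beta}]$, and $\mathrm{Work}[\mathcal{M}_{\mathcal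 I}(u)]=\sum_{(\boldsymbol\alpha,\boldsymbol\beta)\in\mathcal I}\Delta W_{\boldsymbol\alpha,\boldsymbol\beta}$. The error contribution is $\Delta E_{\boldsymbol\alpha,\boldsymbol\beta}=\|\boldsymbol\Delta[u^{\boldsymbol\alpha,\boldsymbol\beta}]\|_U$, and $\mathrm{Error}[\mathcal{M}_{\mathcal I}(u)]=\|u-\mathcal{M}_{\mathcal I}(u)\|_U$. The corresponding bounds for the deterministic contributions (fixed $\bar{\boldsymbol\beta}$) and stochastic contributions (fixed $\bar{\boldsymbol\alpha}$), i.e. for the cost and the $U$-norm of $\Delta^{\mathrm{det}}[u^{\boldsymbol\alpha,\bar{\boldsymbol\beta}}]$ and $\Delta^{\mathrm{stoc}}[u^{\bar{\boldsymbol\alpha},\boldsymbol\beta}]$, are $$\Delta W^{\mathrm{det}}_{\boldsymbol\alpha,\bar{\boldsymbol\beta}}\le C^{\mathrm{det},\bar{\boldsymbol\beta}}_{\mathrm{work}}\prod_{n=1}^D2^{\alpha_n\widetilde\gamma_n},\quad \Delta E^{\mathrm{det}}_{\boldsymbol\alpha,\bar{\boldsymbol\beta}}\le C^{\mathrm{det},\bar{\boldsymbol\beta}}_{\mathrm{error}}\prod_{n=1}^D2^{-\alpha_n\widetilde r_n},$$ $$\Delta W^{\mathrm{stoc}}_{\bar{\boldsymbol\alpha},\boldsymbol\beta}\le C^{\mathrm{stoc},\bar{\boldsymbol\alpha}}_{\mathrm{work}}\prod_{n=1}^N(\beta_n+1),\quad \Delta E^{\mathrm{stoc}}_{\bar{\boldsymbol\alpha},\boldsymbol\beta}\le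 C^{\mathrm{stoc},\bar{\boldsymbol\alpha}}_{\mathrm{error}}\prod_{n=1}^Ne^{-\widetilde g_n(\beta_n+1)}.$$ *)

theory Defs
  imports "HOL-Analysis.Analysis"
begin

text \<open>
  Conventions. The number of random parameters is the cardinality of the finite type
  \<open>'n\<close>, the number of spatial discretization parameters that of the finite type
  \<open>'d\<close>. A separable Hilbert space is a type of sort \<open>{real_inner, banach,
  second_countable_topology}\<close>; its dual is the type of bounded linear functionals
  \<open>'v \<Rightarrow>\<^sub>L real\<close>.
\<close>

text \<open>The law of the random vector: independent components, uniform on the sets \<open>\<Gamma> n\<close>.
  It has density \<open>\<Prod>n. 1 / \<bar>\<Gamma> n\<bar>\<close> on the product of these sets.\<close>

definition param_law :: "('n::finite \<Rightarrow> real set) \<Rightarrow> ('n \<Rightarrow> real) measure" where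
  "param_law \<Gamma> = Pi\<^sub>M UNIV (\<lambda>n. uniform_measure lborel (\<Gamma> n))"

text \<open>Bochner spaces as sets of functions; equality in them is equality almost everywhere.\<close>

definition Lp_space ::
  "'a measure \<Rightarrow> real \<Rightarrow> ('a \<Rightarrow> 'b::{real_normed_vector, second_countable_topology}) set" where
  "Lp_space M p = {f \<in> borel_measurable M. integrable M (\<lambda>x. norm (f x) powr p)}"

definition Lp_norm :: "'a measure \<Rightarrow> real \<Rightarrow> ('a \<Rightarrow> 'b::real_normed_vector) \<Rightarrow> real" where
  "Lp_norm M p f = (\<integral>x. norm (f x) powr p \<partial>M) powr (1 / p)"

definition has_gateaux_derivative ::
  "('a::real_normed_vector \<Rightarrow> 'b::real_normed_vector) \<Rightarrow> ('a \<Rightarrow>\<^sub>L 'b) \<Rightarrow> 'a \<Rightarrow> bool" where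
  "has_gateaux_derivative f A x \<longleftrightarrow>
     (\<forall>v. ((\<lambda>t::real. (f (x + t *\<^sub>R v) - f x) /\<^sub>R t) \<longlongrightarrow> blinfun_apply A v) (at 0))"

text \<open>
  The quantity of interest maps a random field \<open>y\<close> to the random variable
  \<open>\<zeta> \<mapsto> F \<zeta> (y \<zeta>)\<close>. It has to act pointwise in the parameter since the
  discrete problem evaluates it on nodal values only and its derivative is tested pointwise
  against elements of the state space. Convexity and differentiability, however, are those of
  the induced operator from \<open>L\<^sup>p\<close> to \<open>L\<^sup>q\<close>, where random variables are ordered
  almost everywhere.
\<close>

definition maps_Lp_Lq where
  "maps_Lp_Lq M p q F \<longleftrightarrow>
     (\<forall>y\<in>Lp_space M p. (\<lambda>\<zeta>. F \<zeta> (y \<zeta>) :: real) \<in> Lp_space M q)"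

definition convex_Lp where
  "convex_Lp M p F \<longleftrightarrow>
     (\<forall>y\<in>Lp_space M p. \<forall>z\<in>Lp_space M p. \<forall>t\<in>{0..1::real}. AE \<zeta> in M.
        (F \<zeta> (t *\<^sub>R y \<zeta> + (1 - t) *\<^sub>R z \<zeta>) :: real)
          \<le> t * F \<zeta> (y \<zeta>) + (1 - t) * F \<zeta> (z \<zeta>))"

text \<open>Frechet differentiability from \<open>L\<^sup>p\<close> to \<open>L\<^sup>q\<close>, the derivative at \<open>y\<close> being
  \<open>h \<mapsto> (\<zeta> \<mapsto> dF \<zeta> (y \<zeta>) (h \<zeta>))\<close>.\<close>

definition frechet_Lp_Lq ::
  "'a measure \<Rightarrow> real \<Rightarrow> real \<Rightarrow>
   ('a \<Rightarrow> 'v::{real_normed_vector, second_countable_topology} \<Rightarrow> real) \<Rightarrow>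
   ('a \<Rightarrow> 'v \<Rightarrow> ('v \<Rightarrow>\<^sub>L real)) \<Rightarrow> bool" where
  "frechet_Lp_Lq M p q F dF \<longleftrightarrow>
     (\<forall>y\<in>Lp_space M p.
        (\<exists>K. \<forall>h\<in>Lp_space M p.
           (\<lambda>\<zeta>. dF \<zeta> (y \<zeta>) (h \<zeta>)) \<in> Lp_space M q \<and>
           Lp_norm M q (\<lambda>\<zeta>. dF \<zeta> (y \<zeta>) (h \<zeta>)) \<le> K * Lp_norm M p h) \<and>
        (\<forall>\<epsilon>>0. \<exists>\<delta>>0. \<forall>h\<in>Lp_space M p. Lp_norm M p h \<le> \<delta> \<longrightarrow>
           Lp_norm M q (\<lambda>\<zeta>. F \<zeta> (y \<zeta> + h \<zeta>) - F \<zeta> (y \<zeta>) - dF \<zeta> (y \<zeta>) (h \<zeta>))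
             \<le> \<epsilon> * Lp_norm M p h))"

text \<open>\<open>S \<zeta>\<close> is the solution operator of the state equation at the parameter \<open>\<zeta>\<close>.\<close>

definition objective ::
  "('n::finite \<Rightarrow> real set) \<Rightarrow> real \<Rightarrow> (('n \<Rightarrow> real) \<Rightarrow> 'v \<Rightarrow> real) \<Rightarrow>
   (('n \<Rightarrow> real) \<Rightarrow> 'u::real_normed_vector \<Rightarrow> 'v) \<Rightarrow> 'u \<Rightarrow> real" where
  "objective \<Gamma> \<nu> F S w = (\<integral>\<zeta>. F \<zeta> (S \<zeta> w) \<partial>param_law \<Gamma>) + \<nu> / 2 * (norm w)\<^sup>2"

text \<open>
  In the assumption on the adjoint state \<open>pa\<close>, \<open>A \<zeta>\<close> is the (linearized) state operator at
  \<open>S \<zeta> u\<close>, which for \<open>e\<close> linear in the state is that operator itself, and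
  \<open>v \<mapsto> A \<zeta> v (pa \<zeta>)\<close> is its adjoint applied to \<open>pa \<zeta>\<close>. Likewise the adjoint of
  \<open>B\<close> applied to \<open>x\<close> is \<open>v \<mapsto> B v x\<close>. The two customary signs of the right-hand side of
  the adjoint equation are both covered by the parameter \<open>\<sigma>\<close>: with the gradient written as
  \<open>\<nu> u - B\<^sup>* E[pa]\<close>, the chain rule yields \<open>\<sigma> = -1\<close>, whereas the equation is often
  displayed with \<open>\<sigma> = 1\<close>.
\<close>

locale random_ocp =
  fixes \<Gamma> :: "'n::finite \<Rightarrow> real set"
    and B :: "'u::{real_inner, banach, second_countable_topology} \<Rightarrow>\<^sub>L
              ('v::{real_inner, banach, second_countable_topology} \<Rightarrow>\<^sub>L real)"
    and \<phi> :: "'v \<Rightarrow>\<^sub>L real"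
    and \<nu> :: real
    and e :: "'v \<Rightarrow> ('n \<Rightarrow> real) \<Rightarrow> ('v \<Rightarrow>\<^sub>L real)"
    and S :: "('n \<Rightarrow> real) \<Rightarrow> 'u \<Rightarrow> 'v"
    and p q :: real
    and F :: "('n \<Rightarrow> real) \<Rightarrow> 'v \<Rightarrow> real"
    and dF :: "('n \<Rightarrow> real) \<Rightarrow> 'v \<Rightarrow> ('v \<Rightarrow>\<^sub>L real)"
    and u :: 'u
    and pa :: "('n \<Rightarrow> real) \<Rightarrow> 'v"
    and \<sigma> :: real
  assumes params_compact: "\<And>n. compact (\<Gamma> n)"
    and params_measure: "\<And>n. 0 < measure lborel (\<Gamma> n)"
    and nu_pos: "0 < \<nu>"
    and exponents: "1 \<le> p" "1 \<le> q"
    and state_equation: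
      "\<And>w. AE \<zeta> in param_law \<Gamma>. \<forall>v. e (S \<zeta> w) \<zeta> v = (\<phi> + B w) v"
    and state_Lp: "\<And>w. (\<lambda>\<zeta>. S \<zeta> w) \<in> Lp_space (param_law \<Gamma>) p"
    and state_unique:
      "\<And>w y. y \<in> Lp_space (param_law \<Gamma>) p \<Longrightarrow>
         AE \<zeta> in param_law \<Gamma>. \<forall>v. e (y \<zeta>) \<zeta> v = (\<phi> + B w) v \<Longrightarrow>
         AE \<zeta> in param_law \<Gamma>. y \<zeta> = S \<zeta> w"
    and solution_gateaux:
      "AE \<zeta> in param_law \<Gamma>. \<forall>w. \<exists>A. has_gateaux_derivative (S \<zeta>) A w"
    and F_maps: "maps_Lp_Lq (param_law \<Gamma>) p q F"
    and F_convex: "convex_Lp (param_law \<Gamma>) p F"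
    and F_frechet: "frechet_Lp_Lq (param_law \<Gamma>) p q F dF"
    and optimal: "\<And>w. objective \<Gamma> \<nu> F S u \<le> objective \<Gamma> \<nu> F S w"
    and sign: "\<sigma> = 1 \<or> \<sigma> = -1"
    and adjoint_integrable: "integrable (param_law \<Gamma>) pa"
    and adjoint_equation:
      "\<exists>A. AE \<zeta> in param_law \<Gamma>.
         has_gateaux_derivative (\<lambda>y. e y \<zeta>) (A \<zeta>) (S \<zeta> u) \<and>
         (\<forall>v. blinfun_apply (A \<zeta> v) (pa \<zeta>) = \<sigma> * dF \<zeta> (S \<zeta> u) v)"
    and gradient:
      "(objective \<Gamma> \<nu> F S has_derivative
         (\<lambda>v. \<nu> * (u \<bullet> v) - B v (\<integral>\<zeta>. pa \<zeta> \<partial>param_law \<Gamma>))) (at u)"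
    and stationary: "\<And>v. \<nu> * (u \<bullet> v) - B v (\<integral>\<zeta>. pa \<zeta> \<partial>param_law \<Gamma>) = 0"
    and second_order:
      "\<exists>(dJ :: 'u \<Rightarrow> ('u \<Rightarrow>\<^sub>L real)) (H :: 'u \<Rightarrow> ('u \<Rightarrow>\<^sub>L 'u \<Rightarrow>\<^sub>L real)).
         (\<forall>w. (objective \<Gamma> \<nu> F S has_derivative blinfun_apply (dJ w)) (at w)) \<and>
         (\<forall>w. (dJ has_derivative blinfun_apply (H w)) (at w)) \<and>
         (\<forall>v. v \<noteq> 0 \<longrightarrow> 0 < H u v v) \<and>
         (\<exists>K. K o\<^sub>L H u = id_blinfun \<and> H u o\<^sub>L K = id_blinfun) \<and>
         (\<exists>\<delta>>0. \<exists>Lip. Lip-lipschitz_on (ball u \<delta>) H)"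

text \<open>Rule \<open>b\<close> in direction \<open>j\<close> has the \<open>m b\<close> nodes \<open>x j b k\<close> and weights
  \<open>w j b k\<close>, \<open>k < m b\<close>; a node of the tensor rule is selected by one index per direction.\<close>

definition tensor_index :: "(nat \<Rightarrow> nat) \<Rightarrow> ('n \<Rightarrow> nat) \<Rightarrow> ('n \<Rightarrow> nat) set" where
  "tensor_index m \<beta> = (\<Pi>\<^sub>E j\<in>UNIV. {..<m (\<beta> j)})"

definition tensor_node ::
  "('n \<Rightarrow> nat \<Rightarrow> nat \<Rightarrow> real) \<Rightarrow> ('n \<Rightarrow> nat) \<Rightarrow> ('n \<Rightarrow> nat) \<Rightarrow> 'n \<Rightarrow> real" where
  "tensor_node x \<beta> k = (\<lambda>j. x j (\<beta> j) (k j))"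

definition tensor_nodes where
  "tensor_nodes m x \<beta> = tensor_node x \<beta> ` tensor_index m \<beta>"

definition tensor_quadrature ::
  "(nat \<Rightarrow> nat) \<Rightarrow> ('n::finite \<Rightarrow> nat \<Rightarrow> nat \<Rightarrow> real) \<Rightarrow> ('n \<Rightarrow> nat \<Rightarrow> nat \<Rightarrow> real) \<Rightarrow>
   ('n \<Rightarrow> nat) \<Rightarrow> (('n \<Rightarrow> real) \<Rightarrow> real) \<Rightarrow> real" where
  "tensor_quadrature m x w \<beta> g =
     (\<Sum>k\<in>tensor_index m \<beta>. (\<Prod>j\<in>UNIV. w j (\<beta> j) (k j)) * g (tensor_node x \<beta> k))"

text \<open>Only the values of the discrete state \<open>y\<close> at the nodes \<open>Nd\<close> matter.\<close>

definition discrete_feasible where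
  "discrete_feasible B \<phi> e Nd Uh Vh w y \<longleftrightarrow>
     w \<in> Uh \<and> (\<forall>\<zeta>\<in>Nd. y \<zeta> \<in> Vh \<and>
       (\<forall>v\<in>Vh. blinfun_apply (e (y \<zeta>) \<zeta>) v = blinfun_apply (\<phi> + blinfun_apply B w) v))"

definition discrete_solution where
  "discrete_solution B \<phi> \<nu> e F m x w Uh Vh \<beta> u \<longleftrightarrow>
     (\<exists>y. discrete_feasible B \<phi> e (tensor_nodes m x \<beta>) Uh Vh u y \<and>
       (\<forall>u' y'. discrete_feasible B \<phi> e (tensor_nodes m x \<beta>) Uh Vh u' y' \<longrightarrow>
          tensor_quadrature m x w \<beta> (\<lambda>\<zeta>. F \<zeta> (y \<zeta>)) + \<nu> / 2 * (norm u)\<^sup>2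
            \<le> tensor_quadrature m x w \<beta> (\<lambda>\<zeta>. F \<zeta> (y' \<zeta>)) + \<nu> / 2 * (norm u')\<^sup>2))"

definition pos_index :: "('i \<Rightarrow> nat) \<Rightarrow> bool" where
  "pos_index \<alpha> \<longleftrightarrow> (\<forall>i. 1 \<le> \<alpha> i)"

definition pos_indices :: "(('d \<Rightarrow> nat) \<times> ('n \<Rightarrow> nat)) set" where
  "pos_indices = {(\<alpha>, \<beta>). pos_index \<alpha> \<and> pos_index \<beta>}"

text \<open>The surpluses are used at indices with all components positive only, where the
  subtraction on \<open>nat\<close> is not truncated. That the family of approximations vanishes as
  soon as one component is zero is an assumption of \<open>discretized_ocp\<close>.\<close>

definition surplus_det ::
  "(('d::finite \<Rightarrow> nat) \<Rightarrow> ('n \<Rightarrow> nat) \<Rightarrow> 'u::real_vector) \<Rightarrow> ('d \<Rightarrow> nat) \<Rightarrow> ('n \<Rightarrow> nat) \<Rightarrow> 'u" where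
  "surplus_det f \<alpha> \<beta> =
     (\<Sum>j\<in>UNIV \<rightarrow>\<^sub>E {0, 1}. (-1) ^ (\<Sum>i\<in>UNIV. j i) *\<^sub>R f (\<lambda>i. \<alpha> i - j i) \<beta>)"

definition surplus_stoc ::
  "(('d \<Rightarrow> nat) \<Rightarrow> ('n::finite \<Rightarrow> nat) \<Rightarrow> 'u::real_vector) \<Rightarrow> ('d \<Rightarrow> nat) \<Rightarrow> ('n \<Rightarrow> nat) \<Rightarrow> 'u" where
  "surplus_stoc f \<alpha> \<beta> =
     (\<Sum>j\<in>UNIV \<rightarrow>\<^sub>E {0, 1}. (-1) ^ (\<Sum>i\<in>UNIV. j i) *\<^sub>R f \<alpha> (\<lambda>i. \<beta> i - j i))"

definition surplus ::
  "(('d::finite \<Rightarrow> nat) \<Rightarrow> ('n::finite \<Rightarrow> nat) \<Rightarrow> 'u::real_vector) \<Rightarrow> ('d \<Rightarrow> nat) \<Rightarrow> ('n \<Rightarrow> nat) \<Rightarrow> 'u" where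
  "surplus f = surplus_stoc (surplus_det f)"

definition combination ::
  "(('d::finite \<Rightarrow> nat) \<Rightarrow> ('n::finite \<Rightarrow> nat) \<Rightarrow> 'u::real_vector) \<Rightarrow>
   (('d \<Rightarrow> nat) \<times> ('n \<Rightarrow> nat)) set \<Rightarrow> 'u" where
  "combination f I = (\<Sum>(\<alpha>, \<beta>)\<in>I. surplus f \<alpha> \<beta>)"

definition combination_work ::
  "(('d \<Rightarrow> nat) \<Rightarrow> ('n \<Rightarrow> nat) \<Rightarrow> real) \<Rightarrow> (('d \<Rightarrow> nat) \<times> ('n \<Rightarrow> nat)) set \<Rightarrow> real" where
  "combination_work \<Delta>W I = (\<Sum>(\<alpha>, \<beta>)\<in>I. \<Delta>W \<alpha> \<beta>)"

definition combination_error where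
  "combination_error u f I = norm (u - combination f I)"

definition index_set ::
  "('d::finite \<Rightarrow> real) \<Rightarrow> ('d \<Rightarrow> real) \<Rightarrow> ('n::finite \<Rightarrow> real) \<Rightarrow> real \<Rightarrow>
   (('d \<Rightarrow> nat) \<times> ('n \<Rightarrow> nat)) set" where
  "index_set r \<gamma> g L =
     {(\<alpha>, \<beta>) \<in> pos_indices.
        (\<Sum>n\<in>UNIV. (r n + \<gamma> n) * real (\<alpha> n)) + (\<Sum>n\<in>UNIV. g n * (real (\<beta> n) + 1))
          + (\<Sum>n\<in>UNIV. ln (real (\<beta> n) + 1)) \<le> L}"

text \<open>Finiteness ensures that the sums over index sets are genuine
  (\<open>sum\<close> over an infinite set would be \<open>0\<close>).\<close>

lemma finite_index_set:
  assumes "\<And>n. 0 < r n" "\<And>n. 0 < \<gamma> n" "\<And>n. 0 < g n"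
  shows "finite (index_set r \<gamma> g L)"
proof -
  define a where "a = Min (range (\<lambda>n. r n + \<gamma> n))"
  define b where "b = Min (range g)"
  have a: "0 < a" "a \<le> r n + \<gamma> n" for n
    using assms by (auto simp: a_def add_pos_pos)
  have b: "0 < b" "b \<le> g n" for n
    using assms by (auto simp: b_def)
  define K where "K = nat \<lceil>L / a\<rceil> + nat \<lceil>L / b\<rceil>"
  have K: "L / a \<le> real K" "L / b \<le> real K"
    unfolding K_def by linarith+
  have "\<alpha> i \<le> K \<and> \<beta> j \<le> K" if "(\<alpha>, \<beta>) \<in> index_set r \<gamma> g L" for \<alpha> \<beta> i j
  proof -
    have le: "(\<Sum>n\<in>UNIV. (r n + \<gamma> n) * real (\<alpha> n)) + (\<Sum>n\<in>UNIV. g n * (real (\<beta> n) + 1))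
          + (\<Sum>n\<in>UNIV. ln (real (\<beta> n) + 1)) \<le> L"
      using that by (simp add: index_set_def)
    have l: "0 \<le> (\<Sum>n\<in>UNIV. ln (real (\<beta> n) + 1))"
      by (intro sum_nonneg) simp
    have 1: "(r i + \<gamma> i) * real (\<alpha> i) \<le> (\<Sum>n\<in>UNIV. (r n + \<gamma> n) * real (\<alpha> n))"
      using assms(1,2) by (intro member_le_sum mult_nonneg_nonneg add_nonneg_nonneg)
        (simp_all add: less_imp_le)
    have 2: "g j * (real (\<beta> j) + 1) \<le> (\<Sum>n\<in>UNIV. g n * (real (\<beta> n) + 1))"
      using assms(3) by (intro member_le_sum mult_nonneg_nonneg) (simp_all add: less_imp_le)
    have 3: "a * real (\<alpha> i) \<le> (r i + \<gamma> i) * real (\<alpha> i)"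
      using a by (intro mult_right_mono) auto
    have 4: "b * real (\<beta> j) \<le> g j * (real (\<beta> j) + 1)"
      using b by (intro mult_mono) (auto intro: less_imp_le[OF assms(3)])
    have 5: "0 \<le> a * real (\<alpha> i)" "0 \<le> b * real (\<beta> j)"
      using a(1) b(1) by simp_all
    have "a * real (\<alpha> i) \<le> L" "b * real (\<beta> j) \<le> L"
      using le l 1 2 3 4 5 by linarith+
    then have "real (\<alpha> i) \<le> L / a" "real (\<beta> j) \<le> L / b"
      using a(1) b(1) by (simp_all add: field_simps)
    then show ?thesis
      using K by linarith
  qed
  then have "index_set r \<gamma> g L \<subseteq> (UNIV \<rightarrow>\<^sub>E {..K}) \<times> (UNIV \<rightarrow>\<^sub>E {..K})"
    by (auto simp: PiE_def Pi_def extensional_def)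
  then show ?thesis
    by (rule finite_subset) (intro finite_cartesian_product finite_PiE; simp)
qed

text \<open>The mesh size in direction \<open>n\<close> at level \<open>a\<close> is \<open>h n a\<close>, and \<open>US\<close>, \<open>VS\<close> assign the
  approximation spaces to a vector of mesh sizes. The filter in \<open>convergence\<close> is that of
  componentwise divergence, the order on multi-indices being the pointwise one.\<close>

locale discretized_ocp = random_ocp \<Gamma> B \<phi> \<nu> e S p q F dF u pa \<sigma>
  for \<Gamma> :: "'n::finite \<Rightarrow> real set"
    and B :: "'u::{real_inner, banach, second_countable_topology} \<Rightarrow>\<^sub>L
              ('v::{real_inner, banach, second_countable_topology} \<Rightarrow>\<^sub>L real)"
    and \<phi> \<nu> e S p q F dF u pa \<sigma> +
  fixes m :: "nat \<Rightarrow> nat"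
    and x w :: "'n \<Rightarrow> nat \<Rightarrow> nat \<Rightarrow> real"
    and h :: "'d::finite \<Rightarrow> nat \<Rightarrow> real"
    and US :: "('d \<Rightarrow> real) \<Rightarrow> 'u set"
    and VS :: "('d \<Rightarrow> real) \<Rightarrow> 'v set"
    and uab :: "('d \<Rightarrow> nat) \<Rightarrow> ('n \<Rightarrow> nat) \<Rightarrow> 'u"
  assumes nodes_in: "\<And>j b k. 1 \<le> b \<Longrightarrow> k < m b \<Longrightarrow> x j b k \<in> \<Gamma> j"
    and nodes_inj: "\<And>j b. 1 \<le> b \<Longrightarrow> inj_on (x j b) {..<m b}"
    and US_finite_dim:
      "\<And>\<alpha>. pos_index \<alpha> \<Longrightarrow> \<exists>A. finite A \<and> US (\<lambda>n. h n (\<alpha> n)) = span A"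
    and VS_finite_dim:
      "\<And>\<alpha>. pos_index \<alpha> \<Longrightarrow> \<exists>A. finite A \<and> VS (\<lambda>n. h n (\<alpha> n)) = span A"
    and uab_solution:
      "\<And>\<alpha> \<beta>. pos_index \<alpha> \<Longrightarrow> pos_index \<beta> \<Longrightarrow>
         discrete_solution B \<phi> \<nu> e F m x w (US (\<lambda>n. h n (\<alpha> n))) (VS (\<lambda>n. h n (\<alpha> n))) \<beta>
           (uab \<alpha> \<beta>)"
    and uab_zero: "\<And>\<alpha> \<beta>. \<not> (pos_index \<alpha> \<and> pos_index \<beta>) \<Longrightarrow> uab \<alpha> \<beta> = 0"
    and convergence: "((\<lambda>(\<alpha>, \<beta>). uab \<alpha> \<beta>) \<longlongrightarrow> u) (at_top \<times>\<^sub>F at_top)"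
    and surplus_summable: "(\<lambda>(\<alpha>, \<beta>). norm (surplus uab \<alpha> \<beta>)) summable_on pos_indices"

end

theory Submission
  imports Defs "HOL-Real_Asymp.Real_Asymp"
begin

text \<open>
  Let \<open>X\<close> be the functional whose sublevel sets are the index sets. The error bound of an
  index is its work bound times \<open>exp (-X)\<close>. The work bounds over \<open>X \<le> T\<close> sum up to
  \<open>O (exp (chi T) (1 + T)^(n_chi - 1))\<close>: one spatial direction with maximal \<open>\<Theta>\<close> is summed
  geometrically, each further such direction contributes a factor \<open>1 + T\<close>, and the sums over
  all other directions converge. Applied to the unit layers of \<open>X\<close>, the same estimate shows
  that the error bounds over \<open>X > L\<close> sum up to
  \<open>O (exp (-(1 - chi) L) (1 + L)^(n_chi - 1))\<close>, where \<open>1 - chi = chi \<mu>\<close>.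
  That this tail controls the error follows by telescoping the surpluses over the
  boxes \<open>{1..K}\<close> and letting \<open>K\<close> tend to infinity.
\<close>

section \<open>Exponential sums over finite sets and simplices\<close>

lemma sum_power_finite_le:
  fixes q :: real
  assumes "finite A" "0 \<le> q" "q < 1"
  shows "(\<Sum>k\<in>A. q ^ k) \<le> 1 / (1 - q)"
proof -
  have "(\<Sum>k\<in>A. q ^ k) \<le> (\<Sum>k. q ^ k)"
    using assms by (intro sum_le_suminf summable_geometric) auto
  then show ?thesis
    using assms by (simp add: suminf_geometric)
qed

text \<open>Seen from the largest element of \<open>A\<close>, the terms decay geometrically
  downwards, so the last one controls the sum up to a constant. Gaps in \<open>A\<close> are
  allowed, since it will be a fibre of an arbitrary finite set of indices.\<close>

lemma sum_exp_finite_le: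
  fixes s R :: real and A :: "nat set"
  assumes "finite A" "0 < s" and le: "\<And>k. k \<in> A \<Longrightarrow> s * real k \<le> R"
  shows "(\<Sum>k\<in>A. exp (s * real k)) \<le> exp R / (1 - exp (- s))"
proof (cases "A = {}")
  case True
  then show ?thesis using assms by simp
next
  case False
  define K where "K = Max A"
  have K: "K \<in> A" "\<And>k. k \<in> A \<Longrightarrow> k \<le> K"
    using False assms(1) by (auto simp: K_def)
  have "(\<Sum>k\<in>A. exp (s * real k)) = (\<Sum>k\<in>A. exp (s * real K) * exp (- s) ^ (K - k))"
  proof (rule sum.cong[OF refl])
    fix k assume "k \<in> A"
    then have "k \<le> K" by (rule K)
    then show "exp (s * real k) = exp (s * real K) * exp (- s) ^ (K - k)"
      by (simp add: exp_of_nat_mult[symmetric] exp_add[symmetric] of_nat_diff algebra_simps)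
  qed
  also have "\<dots> = exp (s * real K) * (\<Sum>k\<in>A. exp (- s) ^ (K - k))"
    by (simp add: sum_distrib_left)
  also have "(\<Sum>k\<in>A. exp (- s) ^ (K - k)) = (\<Sum>j\<in>(\<lambda>k. K - k) ` A. exp (- s) ^ j)"
    using K by (subst sum.reindex) (auto simp: inj_on_def, metis diff_diff_cancel)
  also have "\<dots> \<le> 1 / (1 - exp (- s))"
    using assms by (intro sum_power_finite_le) auto
  also have "exp (s * real K) * (1 / (1 - exp (- s))) \<le> exp R * (1 / (1 - exp (- s)))"
    using le[OF K(1)] assms by (intro mult_right_mono) auto
  finally show ?thesis by simp
qed

text \<open>Enlarging \<open>F\<close> to the product of its coordinate projections only adds
  nonnegative terms, and over a product set the sum of products factorizes.\<close>

lemma sum_prod_box_le: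
  fixes f :: "'i::finite \<Rightarrow> nat \<Rightarrow> real"
  assumes "finite F" and "\<And>i k. 0 \<le> f i k"
    and "\<And>i. (\<Sum>k\<in>(\<lambda>\<alpha>. \<alpha> i) ` F. f i k) \<le> c i"
  shows "(\<Sum>\<alpha>\<in>F. \<Prod>i\<in>UNIV. f i (\<alpha> i)) \<le> (\<Prod>i\<in>UNIV. c i)"
proof -
  have "(\<Sum>\<alpha>\<in>F. \<Prod>i\<in>UNIV. f i (\<alpha> i))
      \<le> (\<Sum>\<alpha>\<in>(\<Pi>\<^sub>E i\<in>UNIV. (\<lambda>\<alpha>. \<alpha> i) ` F). \<Prod>i\<in>UNIV. f i (\<alpha> i))"
    using assms by (intro sum_mono2 finite_PiE) (auto intro: prod_nonneg)
  also have "\<dots> = (\<Prod>i\<in>UNIV. \<Sum>k\<in>(\<lambda>\<alpha>. \<alpha> i) ` F. f i k)"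
    using assms by (subst prod_sum_PiE) auto
  also have "\<dots> \<le> (\<Prod>i\<in>UNIV. c i)"
    using assms by (intro prod_mono) (auto intro: sum_nonneg)
  finally show ?thesis .
qed

text \<open>The sum over a coordinate \<open>n0\<close> with maximal \<open>\<theta>\<close> is geometric, dominated by its last
  term, and saturates the constraint. Of the other coordinates, only those with maximal
  \<open>\<theta>\<close> contribute a factor growing with \<open>T\<close>.\<close>

lemma sum_exp_simplex_le:
  fixes s \<theta> :: "'d::finite \<Rightarrow> real"
  assumes s: "\<And>n. 0 < s n" and chi: "0 < chi" "\<And>n. \<theta> n \<le> chi" and n0: "\<theta> n0 = chi"
  obtains C where "0 < C"
    "\<And>T F. 0 \<le> T \<Longrightarrow> finite F \<Longrightarrow>
      (\<And>\<alpha>. \<alpha> \<in> F \<Longrightarrow> pos_index \<alpha> \<and> (\<Sum>n\<in>UNIV. s n * real (\<alpha> n)) \<le> T) \<Longrightarrow>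
      (\<Sum>\<alpha>\<in>F. exp (\<Sum>n\<in>UNIV. \<theta> n * (s n * real (\<alpha> n))))
        \<le> C * exp (chi * T) * (1 + T) ^ (card {n. \<theta> n = chi} - 1)"
proof -
  define M where "M = {n. \<theta> n = chi}"
  \<comment> \<open>\<open>v n\<close> is the decay left in coordinate \<open>n\<close> once its
    exponent \<open>\<theta> n\<close> has been raised to \<open>chi\<close>. It is constantly 1 on
    \<open>M\<close> and geometric elsewhere.\<close>
  define v where "v n k = exp (- ((chi - \<theta> n) * s n)) ^ k" for n and k :: nat
  \<comment> \<open>\<open>c n * (1 + T) ^ d n\<close> will bound the sum of \<open>v n\<close> over
    a projection: a single value at \<open>n0\<close>, a count of the values for the other
    coordinates in \<open>M\<close>, a geometric series outside \<open>M\<close>.\<close>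
  define c where "c n = (if n = n0 then 1 else if n \<in> M then 1 / s n
      else 1 / (1 - exp (- ((chi - \<theta> n) * s n))))" for n
  define d :: "'d \<Rightarrow> nat" where "d n = (if n \<in> M - {n0} then 1 else 0)" for n
  have lt: "\<theta> n < chi" if "n \<notin> M" for n
    using chi(2)[of n] that by (simp add: M_def)
  have c_pos: "0 < c n" for n
    using s[of n] lt[of n] by (simp add: c_def)
  have "(\<Sum>n\<in>UNIV. d n) = card (M - {n0})"
    unfolding d_def by (subst sum.If_cases) (simp_all add: set_diff_eq)
  then have sum_d: "(\<Sum>n\<in>UNIV. d n) = card M - 1"
    using n0 by (simp add: M_def)
  have v_M: "v n k = 1" if "n \<in> M" for n k
    using that by (simp add: v_def M_def)
  show thesis
  proof (rule that[of "(\<Prod>n\<in>UNIV. c n) / (1 - exp (- (chi * s n0)))"])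
    show "0 < (\<Prod>n\<in>UNIV. c n) / (1 - exp (- (chi * s n0)))"
      using c_pos chi(1) s[of n0] by (intro divide_pos_pos prod_pos) auto
    fix T :: real and F :: "('d \<Rightarrow> nat) set"
    assume T: "0 \<le> T" and F: "finite F"
      and le: "\<And>\<alpha>. \<alpha> \<in> F \<Longrightarrow> pos_index \<alpha> \<and> (\<Sum>n\<in>UNIV. s n * real (\<alpha> n)) \<le> T"
    \<comment> \<open>Resetting coordinate \<open>n0\<close> makes the fibres of \<open>P\<close>
      lines in direction \<open>n0\<close>. The share \<open>Y\<close> of the other coordinates in
      the constraint is constant on each fibre.\<close>
    define P where "P \<alpha> = \<alpha>(n0 := 0)" for \<alpha> :: "'d \<Rightarrow> nat"
    define Y where "Y \<alpha> = (\<Sum>n\<in>UNIV - {n0}. s n * real (\<alpha> n))" for \<alpha> :: "'d \<Rightarrow> nat"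
    have split: "(\<Sum>n\<in>UNIV. s n * real (\<alpha> n)) = s n0 * real (\<alpha> n0) + Y \<alpha>" for \<alpha>
      unfolding Y_def by (subst sum.remove[of _ n0]) auto
    have term_eq: "exp (\<Sum>n\<in>UNIV. \<theta> n * (s n * real (\<alpha> n)))
        = exp (chi * s n0 * real (\<alpha> n0)) * (exp (chi * Y \<alpha>) * (\<Prod>n\<in>UNIV. v n (P \<alpha> n)))" for \<alpha>
    proof -
      have "(\<Prod>n\<in>UNIV. v n (P \<alpha> n)) = (\<Prod>n\<in>UNIV. v n (\<alpha> n))"
        using n0 by (intro prod.cong) (auto simp: P_def v_M M_def)
      also have "\<dots> = exp (\<Sum>n\<in>UNIV. (\<theta> n - chi) * (s n * real (\<alpha> n)))"
        unfolding v_def exp_sum[OF finite]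
        by (intro prod.cong) (auto simp: exp_of_nat_mult[symmetric] algebra_simps)
      also have "(\<Sum>n\<in>UNIV. (\<theta> n - chi) * (s n * real (\<alpha> n)))
          = (\<Sum>n\<in>UNIV. \<theta> n * (s n * real (\<alpha> n))) - chi * (s n0 * real (\<alpha> n0) + Y \<alpha>)"
        unfolding split[symmetric]
        by (simp add: sum_distrib_left sum_subtractf[symmetric] algebra_simps)
      finally show ?thesis
        by (simp add: exp_add[symmetric] algebra_simps)
    qed
    have Y_P: "Y (P \<alpha>) = Y \<alpha>" and P_P: "P (P \<alpha>) = P \<alpha>" for \<alpha>
      by (simp_all add: Y_def P_def)
    have "(\<Sum>\<alpha>\<in>F. exp (\<Sum>n\<in>UNIV. \<theta> n * (s n * real (\<alpha> n))))
        = (\<Sum>\<alpha>'\<in>P ` F. \<Sum>\<alpha>\<in>{\<alpha>\<in>F. P \<alpha> = \<alpha>'}. exp (\<Sum>n\<in>UNIV. \<theta> n * (s n * real (\<alpha> n))))"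
      using F by (rule sum.image_gen)
    also have "\<dots> \<le> (\<Sum>\<alpha>'\<in>P ` F. exp (chi * T) / (1 - exp (- (chi * s n0))) * (\<Prod>n\<in>UNIV. v n (\<alpha>' n)))"
    proof (rule sum_mono)
      fix \<alpha>' assume "\<alpha>' \<in> P ` F"
      then have P': "P \<alpha>' = \<alpha>'" by (auto simp: P_P)
      let ?G = "{\<alpha>\<in>F. P \<alpha> = \<alpha>'}"
      have inj: "inj_on (\<lambda>\<alpha>. \<alpha> n0) ?G"
      proof (rule inj_onI)
        fix a b assume *: "a \<in> ?G" "b \<in> ?G" "a n0 = b n0"
        then have "(P a)(n0 := a n0) = (P b)(n0 := b n0)" by simp
        then show "a = b" by (simp add: P_def)
      qed
      have YG: "Y \<alpha> = Y \<alpha>'" if "\<alpha> \<in> ?G" for \<alpha>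
        using that Y_P[of \<alpha>] by auto
      have "(\<Sum>\<alpha>\<in>?G. exp (\<Sum>n\<in>UNIV. \<theta> n * (s n * real (\<alpha> n))))
          = (\<Sum>\<alpha>\<in>?G. exp (chi * s n0 * real (\<alpha> n0)) * (exp (chi * Y \<alpha>') * (\<Prod>n\<in>UNIV. v n (\<alpha>' n))))"
        by (intro sum.cong refl) (auto simp: term_eq Y_P)
      also have "\<dots> = (\<Sum>k\<in>(\<lambda>\<alpha>. \<alpha> n0) ` ?G. exp (chi * s n0 * real k))
          * (exp (chi * Y \<alpha>') * (\<Prod>n\<in>UNIV. v n (\<alpha>' n)))"
        by (simp add: sum.reindex[OF inj] sum_distrib_right)
      \<comment> \<open>On a fibre, coordinate \<open>n0\<close> can use at most the budget
        \<open>T - Y \<alpha>'\<close>. The factor \<open>exp (chi * Y \<alpha>')\<close> then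
        cancels, so \<open>exp (chi * T)\<close> comes out independently of the fibre.\<close>
      also have "\<dots> \<le> exp (chi * (T - Y \<alpha>')) / (1 - exp (- (chi * s n0)))
          * (exp (chi * Y \<alpha>') * (\<Prod>n\<in>UNIV. v n (\<alpha>' n)))"
      proof (intro mult_right_mono sum_exp_finite_le)
        fix k assume "k \<in> (\<lambda>\<alpha>. \<alpha> n0) ` ?G"
        then obtain \<alpha> where \<alpha>: "\<alpha> \<in> ?G" "k = \<alpha> n0" by auto
        then have "s n0 * real k \<le> T - Y \<alpha>'"
          using le[of \<alpha>] YG[of \<alpha>] split[of \<alpha>] by auto
        then show "chi * s n0 * real k \<le> chi * (T - Y \<alpha>')"
          using chi(1) by simp
      qed (use F chi(1) s[of n0] in \<open>auto intro!: mult_nonneg_nonneg prod_nonneg simp: v_def\<close>)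
      also have "\<dots> = exp (chi * T) / (1 - exp (- (chi * s n0))) * (\<Prod>n\<in>UNIV. v n (\<alpha>' n))"
      proof -
        have "exp (chi * T) = exp (chi * (T - Y \<alpha>')) * exp (chi * Y \<alpha>')"
          by (simp add: exp_add[symmetric] algebra_simps)
        then show ?thesis
          by (simp add: mult.assoc)
      qed
      finally show "(\<Sum>\<alpha>\<in>?G. exp (\<Sum>n\<in>UNIV. \<theta> n * (s n * real (\<alpha> n))))
          \<le> exp (chi * T) / (1 - exp (- (chi * s n0))) * (\<Prod>n\<in>UNIV. v n (\<alpha>' n))" .
    qed
    also have "\<dots> = exp (chi * T) / (1 - exp (- (chi * s n0))) * (\<Sum>\<alpha>'\<in>P ` F. \<Prod>n\<in>UNIV. v n (\<alpha>' n))"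
      by (simp add: sum_distrib_left)
    also have "\<dots> \<le> exp (chi * T) / (1 - exp (- (chi * s n0))) * (\<Prod>n\<in>UNIV. c n * (1 + T) ^ d n)"
    proof (intro mult_left_mono sum_prod_box_le)
      fix i
      let ?A = "(\<lambda>\<alpha>. \<alpha> i) ` P ` F"
      have fin: "finite ?A" using F by simp
      consider "i = n0" | "i \<noteq> n0" "i \<in> M" | "i \<noteq> n0" "i \<notin> M" by blast
      then show "(\<Sum>k\<in>?A. v i k) \<le> c i * (1 + T) ^ d i"
      proof cases
        case 1
        then have "?A \<subseteq> {0}" by (auto simp: P_def)
        then have "(\<Sum>k\<in>?A. v i k) \<le> (\<Sum>k\<in>{0}. v i k)"
          by (intro sum_mono2) (auto simp: v_def)
        then show ?thesis
          using 1 by (simp add: v_def c_def d_def)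
      next
        case 2
        \<comment> \<open>Positive indices start at 1, so at most \<open>T / s i\<close> values
          occur, with no extra one for 0. This is why \<open>1 / s i\<close> suffices as the
          constant.\<close>
        have "?A \<subseteq> {1..nat \<lfloor>T / s i\<rfloor>}"
        proof
          fix k assume "k \<in> ?A"
          then obtain \<alpha> where \<alpha>: "\<alpha> \<in> F" "k = \<alpha> i"
            using 2 by (auto simp: P_def)
          have "s i * real (\<alpha> i) \<le> (\<Sum>n\<in>UNIV. s n * real (\<alpha> n))"
            using s by (intro member_le_sum) (auto simp: less_imp_le)
          then have "s i * real k \<le> T"
            using le[OF \<alpha>(1)] \<alpha>(2) by simp
          then have "real k \<le> T / s i"
            using s[of i] by (simp add: field_simps)
          then show "k \<in> {1..nat \<lfloor>T / s i\<rfloor>}"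
            using le[OF \<alpha>(1)] \<alpha>(2) by (auto simp: pos_index_def le_nat_floor)
        qed
        then have "card ?A \<le> card {1..nat \<lfloor>T / s i\<rfloor>}"
          by (intro card_mono) auto
        then have "real (card ?A) \<le> real (nat \<lfloor>T / s i\<rfloor>)"
          by simp
        also have "\<dots> \<le> T / s i"
          using T s[of i] by (simp add: of_nat_floor)
        also have "\<dots> \<le> (1 + T) / s i"
          using s[of i] by (simp add: divide_right_mono)
        finally show ?thesis
          using 2 by (simp add: v_M c_def d_def)
      next
        case 3
        then have "(\<Sum>k\<in>?A. v i k) \<le> 1 / (1 - exp (- ((chi - \<theta> i) * s i)))"
          unfolding v_def using fin lt[of i] s[of i] by (intro sum_power_finite_le) auto
        then show ?thesis
          using 3 by (simp add: c_def d_def)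
      qed
    qed (use F chi(1) s[of n0] in \<open>auto simp: v_def\<close>)
    also have "\<dots> = (\<Prod>n\<in>UNIV. c n) / (1 - exp (- (chi * s n0))) * exp (chi * T) * (1 + T) ^ (card M - 1)"
      by (simp add: prod.distrib power_sum[symmetric] sum_d)
    finally show "(\<Sum>\<alpha>\<in>F. exp (\<Sum>n\<in>UNIV. \<theta> n * (s n * real (\<alpha> n))))
        \<le> (\<Prod>n\<in>UNIV. c n) / (1 - exp (- (chi * s n0))) * exp (chi * T)
          * (1 + T) ^ (card {n. \<theta> n = chi} - 1)"
      by (simp add: M_def)
  qed
qed

section \<open>Telescoping of the surpluses and the error of a combination\<close>

text \<open>The coefficient of \<open>f c\<close> in the sum factorizes over the coordinates.\<close>

lemma sum_alternating_telescope:
  fixes f :: "('i::finite \<Rightarrow> nat) \<Rightarrow> 'u::real_vector"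
  assumes zero: "\<And>c i. c i = 0 \<Longrightarrow> f c = 0"
  shows "(\<Sum>a\<in>UNIV \<rightarrow>\<^sub>E {1..K}. \<Sum>j\<in>UNIV \<rightarrow>\<^sub>E {0, 1}.
      (-1) ^ (\<Sum>i\<in>UNIV. j i) *\<^sub>R f (\<lambda>i. a i - j i)) = f (\<lambda>i. K)"
proof -
  \<comment> \<open>The one-dimensional coefficient with which the summand at \<open>a\<close> and
    \<open>j\<close> contributes to the value at \<open>c\<close>. The alternating sign splits over
    the coordinates as well.\<close>
  define \<delta> :: "nat \<Rightarrow> nat \<Rightarrow> nat \<Rightarrow> real"
    where "\<delta> c a j = (if c = a - j then (-1) ^ j else 0)" for c a j
  let ?A = "(UNIV :: 'i set) \<rightarrow>\<^sub>E {1..K}" and ?J = "(UNIV :: 'i set) \<rightarrow>\<^sub>E {0, 1::nat}"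
  let ?C = "(UNIV :: 'i set) \<rightarrow>\<^sub>E {..K}"
  have fin: "finite ?A" "finite ?J" "finite ?C"
    by (auto intro: finite_PiE)
  have prod_\<delta>: "(\<Prod>i\<in>UNIV. \<delta> (c i) (a i) (j i))
      = (if c = (\<lambda>i. a i - j i) then (-1) ^ (\<Sum>i\<in>UNIV. j i) else 0)"
    for c a j :: "'i \<Rightarrow> nat"
    by (auto simp: \<delta>_def power_sum fun_eq_iff)
  \<comment> \<open>A positive \<open>c\<close> occurs with sign + for \<open>a = c\<close> and with
    sign - for \<open>a = c + 1\<close>; the latter is out of range only when \<open>c = K\<close>.
    At \<open>c = 0\<close> the positive term would be out of range instead, which is why
    \<open>f\<close> has to vanish there.\<close>
  have coeff: "(\<Sum>a\<in>{1..K}. \<Sum>j\<in>{0, 1}. \<delta> c a j) = (if c = K then 1 else 0)"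
    if "c \<noteq> 0" "c \<le> K" for c
  proof -
    have "(\<Sum>a\<in>{1..K}. \<Sum>j\<in>{0, 1}. \<delta> c a j)
        = (\<Sum>a\<in>{1..K}. (if c = a then 1 else 0) - (if a = Suc c then 1 else 0))"
      by (intro sum.cong) (auto simp: \<delta>_def)
    also have "\<dots> = (if c = K then 1 else 0)"
      using that by (simp add: sum_subtractf)
    finally show ?thesis .
  qed
  have "(\<Sum>a\<in>?A. \<Sum>j\<in>?J. (-1) ^ (\<Sum>i\<in>UNIV. j i) *\<^sub>R f (\<lambda>i. a i - j i))
      = (\<Sum>a\<in>?A. \<Sum>j\<in>?J. \<Sum>c\<in>?C. (\<Prod>i\<in>UNIV. \<delta> (c i) (a i) (j i)) *\<^sub>R f c)"
  proof (intro sum.cong refl)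
    fix a j assume a: "a \<in> ?A"
    let ?c = "\<lambda>i. a i - j i"
    have "?c \<in> ?C"
      using a by (auto simp: PiE_iff le_diff_conv trans_le_add1)
    then have "(\<Sum>c\<in>?C. if c = ?c then (-1) ^ (\<Sum>i\<in>UNIV. j i) *\<^sub>R f c else 0)
        = (-1) ^ (\<Sum>i\<in>UNIV. j i) *\<^sub>R f ?c"
      using fin by (simp add: sum.delta)
    moreover have "(\<Sum>c\<in>?C. (\<Prod>i\<in>UNIV. \<delta> (c i) (a i) (j i)) *\<^sub>R f c)
        = (\<Sum>c\<in>?C. if c = ?c then (-1) ^ (\<Sum>i\<in>UNIV. j i) *\<^sub>R f c else 0)"
      unfolding prod_\<delta> by (intro sum.cong) auto
    ultimately show "(-1) ^ (\<Sum>i\<in>UNIV. j i) *\<^sub>R f ?c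
        = (\<Sum>c\<in>?C. (\<Prod>i\<in>UNIV. \<delta> (c i) (a i) (j i)) *\<^sub>R f c)"
      by simp
  qed
  also have "\<dots> = (\<Sum>c\<in>?C. (\<Sum>a\<in>?A. \<Sum>j\<in>?J. \<Prod>i\<in>UNIV. \<delta> (c i) (a i) (j i)) *\<^sub>R f c)"
    by (simp add: scaleR_sum_left sum.swap[of _ ?C])
  also have "\<dots> = (\<Sum>c\<in>?C. (\<Prod>i\<in>UNIV. \<Sum>a\<in>{1..K}. \<Sum>j\<in>{0, 1}. \<delta> (c i) a j) *\<^sub>R f c)"
    by (subst prod_sum_PiE, simp, simp)+ (simp add: prod_sum_PiE)
  also have "\<dots> = (\<Sum>c\<in>?C. if c = (\<lambda>i. K) then f c else 0)"
  proof (intro sum.cong refl)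
    fix c assume c: "c \<in> ?C"
    show "(\<Prod>i\<in>UNIV. \<Sum>a\<in>{1..K}. \<Sum>j\<in>{0, 1}. \<delta> (c i) a j) *\<^sub>R f c
        = (if c = (\<lambda>i. K) then f c else 0)"
    proof (cases "\<exists>i. c i = 0")
      case True
      then show ?thesis using zero by auto
    next
      case False
      then have "(\<Prod>i\<in>UNIV. \<Sum>a\<in>{1..K}. \<Sum>j\<in>{0, 1}. \<delta> (c i) a j)
          = (\<Prod>i\<in>UNIV. if c i = K then 1 else 0)"
        using c by (intro prod.cong coeff) (auto simp: PiE_iff)
      then show ?thesis
        by (auto simp: fun_eq_iff)
    qed
  qed
  also have "\<dots> = f (\<lambda>i. K)"
    using fin by (simp add: sum.delta PiE_iff)
  finally show ?thesis .
qed

text \<open>The two surpluses act on different arguments and are linear. Hence the sum over \<alpha>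
  can be moved inside the stochastic surplus and telescoped first, and the sum over \<beta>
  afterwards.\<close>

lemma combination_box:
  fixes f :: "('d::finite \<Rightarrow> nat) \<Rightarrow> ('n::finite \<Rightarrow> nat) \<Rightarrow> 'u::real_vector"
  assumes "\<And>\<alpha> \<beta>. \<not> (pos_index \<alpha> \<and> pos_index \<beta>) \<Longrightarrow> f \<alpha> \<beta> = 0"
  shows "combination f ((UNIV \<rightarrow>\<^sub>E {1..K}) \<times> (UNIV \<rightarrow>\<^sub>E {1..K})) = f (\<lambda>i. K) (\<lambda>i. K)"
proof -
  have *: "f \<alpha> \<beta> = 0" if "\<alpha> i = 0 \<or> \<beta> j = 0" for \<alpha> \<beta> i j
    using assms[of \<alpha> \<beta>] that by (metis pos_index_def not_one_le_zero)
  have det: "(\<Sum>\<alpha>\<in>UNIV \<rightarrow>\<^sub>E {1..K}. surplus_det f \<alpha> \<beta>) = f (\<lambda>i. K) \<beta>" for \<beta>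
    unfolding surplus_det_def by (rule sum_alternating_telescope) (use * in blast)
  have "combination f ((UNIV \<rightarrow>\<^sub>E {1..K}) \<times> (UNIV \<rightarrow>\<^sub>E {1..K}))
      = (\<Sum>\<beta>\<in>UNIV \<rightarrow>\<^sub>E {1..K}. \<Sum>\<alpha>\<in>UNIV \<rightarrow>\<^sub>E {1..K}. surplus f \<alpha> \<beta>)"
    unfolding combination_def by (subst sum.swap) (simp add: sum.cartesian_product)
  also have "\<dots> = (\<Sum>\<beta>\<in>UNIV \<rightarrow>\<^sub>E {1..K}. \<Sum>j\<in>UNIV \<rightarrow>\<^sub>E {0, 1}.
      (-1) ^ (\<Sum>i\<in>UNIV. j i) *\<^sub>R f (\<lambda>i. K) (\<lambda>i. \<beta> i - j i))"
    unfolding surplus_def surplus_stoc_def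
    by (subst sum.swap) (simp only: det scaleR_sum_right[symmetric])
  also have "\<dots> = f (\<lambda>i. K) (\<lambda>i. K)"
    by (rule sum_alternating_telescope) (use * in blast)
  finally show ?thesis .
qed

text \<open>With finitely many coordinates, \<open>K\<close> eventually exceeds every component of a
  given multi-index. This lets the limit over multi-indices be taken along the diagonal.\<close>

lemma filterlim_const_fun_at_top:
  "filterlim (\<lambda>K i. K) (at_top :: ('i::finite \<Rightarrow> nat) filter) sequentially"
  unfolding at_top_def[where 'a = "'i \<Rightarrow> nat"]
proof (intro filterlim_INF[THEN iffD2] ballI filterlim_principal[THEN iffD2])
  fix a :: "'i \<Rightarrow> nat"
  have "\<forall>\<^sub>F K in sequentially. \<forall>i. a i \<le> K"
    by (simp add: eventually_all_finite eventually_ge_at_top)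
  then show "\<forall>\<^sub>F K in sequentially. (\<lambda>i. K) \<in> {a..}"
    by eventually_elim (auto simp: le_fun_def)
qed

text \<open>The combination over a large cube is a diagonal value of \<open>f\<close>, which tends
  to \<open>u\<close>. Once the cube contains \<open>I\<close>, it differs from the combination over
  \<open>I\<close> by a finite sum outside \<open>I\<close>; its bound \<open>c\<close> is uniform
  and survives the limit.\<close>

lemma combination_error_le:
  fixes f :: "('d::finite \<Rightarrow> nat) \<Rightarrow> ('n::finite \<Rightarrow> nat) \<Rightarrow> 'u::real_normed_vector"
  assumes zero: "\<And>\<alpha> \<beta>. \<not> (pos_index \<alpha> \<and> pos_index \<beta>) \<Longrightarrow> f \<alpha> \<beta> = 0"
    and lim: "((\<lambda>(\<alpha>, \<beta>). f \<alpha> \<beta>) \<longlongrightarrow> u) (at_top \<times>\<^sub>F at_top)"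
    and I: "finite I" "I \<subseteq> pos_indices"
    and tail: "\<And>F. finite F \<Longrightarrow> F \<subseteq> pos_indices - I \<Longrightarrow> (\<Sum>(\<alpha>, \<beta>)\<in>F. norm (surplus f \<alpha> \<beta>)) \<le> c"
  shows "combination_error u f I \<le> c"
proof -
  let ?B = "\<lambda>K::nat. ((UNIV :: 'd set) \<rightarrow>\<^sub>E {1..K}) \<times> ((UNIV :: 'n set) \<rightarrow>\<^sub>E {1..K})"
  have fin: "finite (?B K)" for K
    by (intro finite_cartesian_product finite_PiE) auto
  have pos: "?B K \<subseteq> pos_indices" for K
    by (auto simp: pos_indices_def pos_index_def PiE_iff)
  have "((\<lambda>K. (\<lambda>(\<alpha>, \<beta>). f \<alpha> \<beta>) ((\<lambda>i. K), (\<lambda>i. K))) \<longlonglongrightarrow> u)"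
    by (rule filterlim_compose[OF lim filterlim_Pair])
      (rule filterlim_const_fun_at_top)+
  then have "(\<lambda>K. combination f (?B K)) \<longlonglongrightarrow> u"
    using combination_box[of f] zero by simp
  then have conv: "(\<lambda>K. norm (combination f (?B K) - combination f I)) \<longlonglongrightarrow> combination_error u f I"
    unfolding combination_error_def by (intro tendsto_intros)
  have "\<forall>\<^sub>F K in sequentially. \<forall>i\<in>I. i \<in> ?B K"
    unfolding eventually_ball_finite_distrib[OF I(1)]
  proof
    fix i assume i: "i \<in> I"
    obtain \<alpha> \<beta> where ab: "i = (\<alpha>, \<beta>)" by (cases i)
    have pos: "pos_index \<alpha>" "pos_index \<beta>"
      using i I(2) ab by (auto simp: pos_indices_def)
    have "\<forall>\<^sub>F K in sequentially. \<forall>n. \<alpha> n \<le> K" "\<forall>\<^sub>F K in sequentially. \<forall>n. \<beta> n \<le> K"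
      by (simp_all add: eventually_all_finite eventually_ge_at_top)
    then show "\<forall>\<^sub>F K in sequentially. i \<in> ?B K"
      by eventually_elim (use pos in \<open>auto simp: ab pos_index_def PiE_iff\<close>)
  qed
  then have "\<forall>\<^sub>F K in sequentially. norm (combination f (?B K) - combination f I) \<le> c"
  proof eventually_elim
    case (elim K)
    then have "I \<subseteq> ?B K" by blast
    then have "combination f (?B K) - combination f I = (\<Sum>(\<alpha>, \<beta>)\<in>?B K - I. surplus f \<alpha> \<beta>)"
      unfolding combination_def using sum_diff[OF fin] by metis
    also have "norm \<dots> \<le> (\<Sum>(\<alpha>, \<beta>)\<in>?B K - I. norm (surplus f \<alpha> \<beta>))"
      using norm_sum[of "\<lambda>(\<alpha>, \<beta>). surplus f \<alpha> \<beta>"] by (simp add: case_prod_unfold)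
    also have "\<dots> \<le> c"
      using fin pos by (intro tail) auto
    finally show ?case .
  qed
  then show ?thesis
    by (rule tendsto_upperbound[OF conv]) simp
qed

section \<open>Summation over the layers of a tail\<close>

text \<open>Half of the decay rate absorbs the polynomial. This serves both the sum over the layers
  and the work factor, linear in each component of \<beta>.\<close>

lemma summable_exp_mult_power:
  fixes \<kappa> c :: real
  assumes "0 < \<kappa>"
  shows "summable (\<lambda>k. exp (- \<kappa>) ^ k * (c + real k) ^ m)"
proof (rule summable_comparison_test_bigo)
  show "summable (\<lambda>k. norm (exp (- \<kappa> / 2) ^ k))"
    using assms by simp
  have "(\<lambda>k. exp (- \<kappa> * real k) * (c + real k) ^ m) \<in> O(\<lambda>k. exp (- \<kappa> / 2 * real k))"
    using assms by real_asymp
  then show "(\<lambda>k. exp (- \<kappa>) ^ k * (c + real k) ^ m) \<in> O(\<lambda>k. exp (- \<kappa> / 2) ^ k)"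
    by (simp add: exp_of_nat_mult[symmetric] mult.commute)
qed

text \<open>Slice the region \<open>X > L\<close> into the layers \<open>L + k < X \<le> L + k + 1\<close>.\<close>

lemma sum_tail_le:
  fixes chi :: real and X t :: "'a \<Rightarrow> real"
  assumes chi: "chi < 1" and t: "\<And>x. 0 \<le> t x" and C: "0 < C"
    and bound: "\<And>T F. 0 \<le> T \<Longrightarrow> finite F \<Longrightarrow> F \<subseteq> S \<Longrightarrow> (\<And>x. x \<in> F \<Longrightarrow> X x \<le> T) \<Longrightarrow>
      (\<Sum>x\<in>F. t x) \<le> C * exp (chi * T) * (1 + T) ^ m"
  obtains C' where "0 < C'"
    "\<And>L F. 0 \<le> L \<Longrightarrow> finite F \<Longrightarrow> F \<subseteq> S \<Longrightarrow> (\<And>x. x \<in> F \<Longrightarrow> L < X x) \<Longrightarrow>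
      (\<Sum>x\<in>F. exp (- X x) * t x) \<le> C' * exp ((chi - 1) * L) * (1 + L) ^ m"
proof -
  define \<kappa> where "\<kappa> = 1 - chi"
  \<comment> \<open>The part of the bound for layer \<open>k\<close> that depends on
    \<open>k\<close>. The estimate \<open>1 + (L + k + 1) \<le> (1 + L) * (2 + k)\<close> separates
    it from \<open>L\<close>.\<close>
  define a where "a k = exp (- \<kappa>) ^ k * (2 + real k) ^ m" for k :: nat
  have "0 < \<kappa>" using chi by (simp add: \<kappa>_def)
  have sm: "summable a"
    unfolding a_def using \<open>0 < \<kappa>\<close> by (rule summable_exp_mult_power)
  have a: "0 < a k" for k by (simp add: a_def add_pos_nonneg)
  show thesis
  proof (rule that[of "C * exp chi * suminf a"])
    show "0 < C * exp chi * suminf a"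
      using C suminf_pos[OF sm a] by simp
    fix L :: real and F
    assume L: "0 \<le> L" and F: "finite F" "F \<subseteq> S" and X: "\<And>x. x \<in> F \<Longrightarrow> L < X x"
    \<comment> \<open>Layers are open below and closed above, hence ceiling minus one. Since
      \<open>L < X x\<close>, the ceiling is at least 1 and \<open>nat\<close> does not
      truncate.\<close>
    define l where "l x = nat (\<lceil>X x - L\<rceil> - 1)" for x
    have l: "L + real (l x) \<le> X x" "X x \<le> L + real (l x) + 1" if "x \<in> F" for x
      using X[OF that] unfolding l_def by linarith+
    have "(\<Sum>x\<in>F. exp (- X x) * t x) = (\<Sum>k\<in>l ` F. \<Sum>x\<in>{x\<in>F. l x = k}. exp (- X x) * t x)"
      using F(1) by (rule sum.image_gen)
    also have "\<dots> \<le> (\<Sum>k\<in>l ` F. C * exp chi * exp ((chi - 1) * L) * (1 + L) ^ m * a k)"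
    proof (rule sum_mono)
      fix k
      let ?G = "{x\<in>F. l x = k}"
      \<comment> \<open>The lower end of the layer bounds \<open>exp (- X x)\<close>; its upper end
        is the level at which \<open>bound\<close> is applied next.\<close>
      have "(\<Sum>x\<in>?G. exp (- X x) * t x) \<le> (\<Sum>x\<in>?G. exp (- (L + k)) * t x)"
        using l(1) t by (intro sum_mono mult_right_mono) fastforce+
      also have "\<dots> = exp (- (L + k)) * (\<Sum>x\<in>?G. t x)"
        by (simp add: sum_distrib_left)
      also have "\<dots> \<le> exp (- (L + k)) * (C * exp (chi * (L + k + 1)) * (1 + (L + k + 1)) ^ m)"
        using L F l by (intro mult_left_mono bound) auto
      also have "\<dots> \<le> exp (- (L + k)) * (C * exp (chi * (L + k + 1)) * ((1 + L) * (2 + k)) ^ m)"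
      proof -
        have "1 + (L + k + 1) \<le> (1 + L) * (2 + real k)"
          using L by (simp add: algebra_simps)
        then show ?thesis
          using C L by (intro mult_left_mono power_mono) auto
      qed
      also have "\<dots> = C * exp chi * exp ((chi - 1) * L) * (1 + L) ^ m * a k"
      proof -
        have "exp (- (L + k)) * exp (chi * (L + k + 1)) = exp chi * exp ((chi - 1) * L) * exp (- \<kappa>) ^ k"
          by (simp add: \<kappa>_def exp_of_nat_mult[symmetric] exp_add[symmetric] algebra_simps)
        then show ?thesis
          by (simp add: a_def power_mult_distrib mult_ac)
      qed
      finally show "(\<Sum>x\<in>?G. exp (- X x) * t x)
          \<le> C * exp chi * exp ((chi - 1) * L) * (1 + L) ^ m * a k" .
    qed
    also have "\<dots> = C * exp chi * exp ((chi - 1) * L) * (1 + L) ^ m * (\<Sum>k\<in>l ` F. a k)"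
      by (simp add: sum_distrib_left)
    also have "\<dots> \<le> C * exp chi * exp ((chi - 1) * L) * (1 + L) ^ m * suminf a"
      using F C L sm a by (intro mult_left_mono sum_le_suminf) (auto intro: less_imp_le)
    finally show "(\<Sum>x\<in>F. exp (- X x) * t x) \<le> C * exp chi * suminf a * exp ((chi - 1) * L) * (1 + L) ^ m"
      by (simp add: mult_ac)
  qed
qed

section \<open>Work sums over sublevel sets of the index weight\<close>

text \<open>Up to constants, \<open>exp (- index_weight r \<gamma> g x)\<close> is the ratio of the
  error bound to the work bound, so sublevel sets collect the most profitable indices.\<close>

definition index_weight ::
  "('d::finite \<Rightarrow> real) \<Rightarrow> ('d \<Rightarrow> real) \<Rightarrow> ('n::finite \<Rightarrow> real) \<Rightarrow> ('d \<Rightarrow> nat) \<times> ('n \<Rightarrow> nat) \<Rightarrow> real" where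
  "index_weight r \<gamma> g = (\<lambda>(\<alpha>, \<beta>). (\<Sum>n\<in>UNIV. (r n + \<gamma> n) * real (\<alpha> n))
     + (\<Sum>n\<in>UNIV. g n * (real (\<beta> n) + 1)) + (\<Sum>n\<in>UNIV. ln (real (\<beta> n) + 1)))"

text \<open>The work bound without its constant, the powers of 2 being rewritten as exponentials
  with the rates \<open>\<gamma> n\<close>.\<close>

definition work_profile ::
  "('d::finite \<Rightarrow> real) \<Rightarrow> ('d \<Rightarrow> nat) \<times> ('n::finite \<Rightarrow> nat) \<Rightarrow> real" where
  "work_profile \<gamma> = (\<lambda>(\<alpha>, \<beta>). exp (\<Sum>n\<in>UNIV. \<gamma> n * real (\<alpha> n)) * (\<Prod>n\<in>UNIV. real (\<beta> n) + 1))"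

lemma index_set_eq: "index_set r \<gamma> g L = {x \<in> pos_indices. index_weight r \<gamma> g x \<le> L}"
  by (auto simp: index_set_def index_weight_def)

lemma work_profile_nonneg: "0 \<le> work_profile \<gamma> x"
  by (cases x) (auto simp: work_profile_def intro!: mult_nonneg_nonneg prod_nonneg)

lemma index_weight_pos:
  fixes r \<gamma> :: "'d::finite \<Rightarrow> real" and g :: "'n::finite \<Rightarrow> real"
  assumes "\<And>n. 0 < r n" "\<And>n. 0 < \<gamma> n" "\<And>n. 0 < g n"
  shows "0 < index_weight r \<gamma> g x"
proof (cases x)
  case (Pair \<alpha> \<beta>)
  have "0 < (\<Sum>n\<in>UNIV. g n * (real (\<beta> n) + 1))"
    using assms by (intro sum_pos) (auto intro!: mult_pos_pos)
  moreover have "0 \<le> (\<Sum>n\<in>UNIV. (r n + \<gamma> n) * real (\<alpha> n))"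
    using assms by (intro sum_nonneg mult_nonneg_nonneg) (auto simp: less_imp_le add_nonneg_nonneg)
  moreover have "0 \<le> (\<Sum>n\<in>UNIV. ln (real (\<beta> n) + 1))"
    by (intro sum_nonneg) simp
  ultimately show ?thesis
    by (simp add: index_weight_def Pair)
qed

text \<open>The terms with \<open>\<gamma> n\<close> and the logarithms in the weight cancel the
  work profile exactly; what remains is the error bound without its constant.\<close>

lemma exp_index_weight_mult_work_profile:
  "exp (- index_weight r \<gamma> g (\<alpha>, \<beta>)) * work_profile \<gamma> (\<alpha>, \<beta>)
    = exp (- (\<Sum>n\<in>UNIV. r n * real (\<alpha> n))) * (\<Prod>n\<in>UNIV. exp (- (g n * (real (\<beta> n) + 1))))"
proof -
  have "(\<Prod>n\<in>UNIV. real (\<beta> n) + 1) = exp (\<Sum>n\<in>UNIV. ln (real (\<beta> n) + 1))"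
    unfolding exp_sum[OF finite] by (intro prod.cong) auto
  moreover have "(\<Sum>n\<in>UNIV. (r n + \<gamma> n) * real (\<alpha> n))
      = (\<Sum>n\<in>UNIV. r n * real (\<alpha> n)) + (\<Sum>n\<in>UNIV. \<gamma> n * real (\<alpha> n))"
    by (simp add: sum.distrib distrib_right)
  moreover have "(\<Prod>n\<in>UNIV. exp (- (g n * (real (\<beta> n) + 1))))
      = exp (- (\<Sum>n\<in>UNIV. g n * (real (\<beta> n) + 1)))"
    by (simp add: exp_sum sum_negf[symmetric])
  ultimately show ?thesis
    by (simp add: index_weight_def work_profile_def exp_add[symmetric])
qed

text \<open>For fixed \<beta> the spatial indices fill a simplex with budget
  \<open>T - b \<beta>\<close>. The resulting factor \<open>exp (- (chi * b \<beta>))\<close>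
  outweighs the work factors \<open>\<beta> n + 1\<close>, so the sum over \<beta> costs only a
  constant.\<close>

lemma sum_work_profile_le:
  fixes r \<gamma> :: "'d::finite \<Rightarrow> real" and g :: "'n::finite \<Rightarrow> real"
  assumes pos: "\<And>n. 0 < r n" "\<And>n. 0 < \<gamma> n" "\<And>n. 0 < g n"
    and chi: "0 < chi" "\<And>n. \<gamma> n / (r n + \<gamma> n) \<le> chi" and n0: "\<gamma> n0 / (r n0 + \<gamma> n0) = chi"
  obtains C where "0 < C"
    "\<And>T F. 0 \<le> T \<Longrightarrow> finite F \<Longrightarrow> F \<subseteq> pos_indices \<Longrightarrow>
      (\<And>x. x \<in> F \<Longrightarrow> index_weight r \<gamma> g x \<le> T) \<Longrightarrow>
      (\<Sum>x\<in>F. work_profile \<gamma> x)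
        \<le> C * exp (chi * T) * (1 + T) ^ (card {n. \<gamma> n / (r n + \<gamma> n) = chi} - 1)"
proof -
  let ?m = "card {n. \<gamma> n / (r n + \<gamma> n) = chi} - 1"
  have s: "0 < r n + \<gamma> n" for n
    using pos by (simp add: add_pos_pos)
  obtain C0 where C0: "0 < C0" and det:
    "\<And>T F. 0 \<le> T \<Longrightarrow> finite F \<Longrightarrow>
      (\<And>\<alpha>. \<alpha> \<in> F \<Longrightarrow> pos_index \<alpha> \<and> (\<Sum>n\<in>UNIV. (r n + \<gamma> n) * real (\<alpha> n)) \<le> T) \<Longrightarrow>
      (\<Sum>\<alpha>\<in>F. exp (\<Sum>n\<in>UNIV. \<gamma> n / (r n + \<gamma> n) * ((r n + \<gamma> n) * real (\<alpha> n))))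
        \<le> C0 * exp (chi * T) * (1 + T) ^ ?m"
    using sum_exp_simplex_le[where s = "\<lambda>n. r n + \<gamma> n" and \<theta> = "\<lambda>n. \<gamma> n / (r n + \<gamma> n)", OF s chi n0]
    by blast
  \<comment> \<open>A summable majorant for one stochastic coordinate; the exponent 1 is written out
    to match \<open>summable_exp_mult_power\<close>.\<close>
  define \<omega> where "\<omega> j k = exp (- (chi * g j)) ^ k * (1 + real k) ^ 1" for j k
  have \<omega>: "summable (\<omega> j)" "0 < \<omega> j k" for j k
    using summable_exp_mult_power[of "chi * g j" 1 1] chi(1) pos(3)[of j]
    unfolding \<omega>_def by (simp_all add: add_pos_nonneg)
  define b where "b \<beta> = (\<Sum>n\<in>UNIV. g n * (real (\<beta> n) + 1)) + (\<Sum>n\<in>UNIV. ln (real (\<beta> n) + 1))"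
    for \<beta> :: "'n \<Rightarrow> nat"
  have b_nonneg: "0 \<le> b \<beta>" for \<beta>
    using pos unfolding b_def by (intro add_nonneg_nonneg sum_nonneg) (auto simp: less_imp_le)
  \<comment> \<open>Dropping the logarithms and the shift by 1 from \<open>b \<beta>\<close> only
    enlarges the exponential, and the rest factorizes.\<close>
  have exp_b: "exp (- (chi * b \<beta>)) * (\<Prod>n\<in>UNIV. real (\<beta> n) + 1) \<le> (\<Prod>n\<in>UNIV. \<omega> n (\<beta> n))" for \<beta>
  proof -
    have "(\<Sum>n\<in>UNIV. g n * real (\<beta> n)) \<le> b \<beta>"
    proof -
      have "(\<Sum>n\<in>UNIV. g n * real (\<beta> n)) \<le> (\<Sum>n\<in>UNIV. g n * (real (\<beta> n) + 1))"
        using pos by (intro sum_mono mult_left_mono) (auto simp: less_imp_le)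
      moreover have "0 \<le> (\<Sum>n\<in>UNIV. ln (real (\<beta> n) + 1))"
        by (intro sum_nonneg) simp
      ultimately show ?thesis by (simp add: b_def)
    qed
    then have "exp (- (chi * b \<beta>)) \<le> exp (- (chi * (\<Sum>n\<in>UNIV. g n * real (\<beta> n))))"
      using chi(1) by simp
    also have "\<dots> = (\<Prod>n\<in>UNIV. exp (- (chi * g n)) ^ \<beta> n)"
      by (simp add: exp_of_nat_mult[symmetric] exp_sum[symmetric] sum_distrib_left sum_negf mult_ac)
    finally have "exp (- (chi * b \<beta>)) * (\<Prod>n\<in>UNIV. real (\<beta> n) + 1)
        \<le> (\<Prod>n\<in>UNIV. exp (- (chi * g n)) ^ \<beta> n) * (\<Prod>n\<in>UNIV. real (\<beta> n) + 1)"
      by (intro mult_right_mono prod_nonneg) auto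
    then show ?thesis
      by (simp add: \<omega>_def prod.distrib add.commute)
  qed
  show thesis
  proof (rule that[of "C0 * (\<Prod>j\<in>UNIV. suminf (\<omega> j))"])
    show "0 < C0 * (\<Prod>j\<in>UNIV. suminf (\<omega> j))"
      using C0 \<omega> by (intro mult_pos_pos prod_pos suminf_pos) auto
    fix T :: real and F :: "(('d \<Rightarrow> nat) \<times> ('n \<Rightarrow> nat)) set"
    assume T: "0 \<le> T" and F: "finite F" "F \<subseteq> pos_indices"
      and le: "\<And>x. x \<in> F \<Longrightarrow> index_weight r \<gamma> g x \<le> T"
    let ?A = "\<lambda>\<beta>. {\<alpha>. (\<alpha>, \<beta>) \<in> F}"
    have fin: "finite (?A \<beta>)" for \<beta>
      by (rule finite_subset[OF _ finite_imageI[OF F(1), of fst]]) force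
    have F_eq: "F = prod.swap ` (SIGMA \<beta>:snd ` F. ?A \<beta>)"
      by force
    have "(\<Sum>x\<in>F. work_profile \<gamma> x) = (\<Sum>(\<beta>, \<alpha>)\<in>(SIGMA \<beta>:snd ` F. ?A \<beta>). work_profile \<gamma> (\<alpha>, \<beta>))"
      by (subst F_eq, subst sum.reindex) (auto simp: case_prod_unfold intro: sum.cong)
    also have "\<dots> = (\<Sum>\<beta>\<in>snd ` F. \<Sum>\<alpha>\<in>?A \<beta>. work_profile \<gamma> (\<alpha>, \<beta>))"
      using F(1) fin by (subst sum.Sigma) auto
    also have "\<dots> \<le> (\<Sum>\<beta>\<in>snd ` F. C0 * exp (chi * T) * (1 + T) ^ ?m * (\<Prod>n\<in>UNIV. \<omega> n (\<beta> n)))"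
    proof (rule sum_mono)
      fix \<beta> assume "\<beta> \<in> snd ` F"
      then obtain \<alpha>0 where \<alpha>0: "(\<alpha>0, \<beta>) \<in> F" by auto
      have A: "pos_index \<alpha> \<and> (\<Sum>n\<in>UNIV. (r n + \<gamma> n) * real (\<alpha> n)) \<le> T - b \<beta>" if "\<alpha> \<in> ?A \<beta>" for \<alpha>
        using that F(2) le[of "(\<alpha>, \<beta>)"] by (auto simp: pos_indices_def index_weight_def b_def)
      \<comment> \<open>The slice over \<beta> is nonempty, so its budget
        \<open>T - b \<beta>\<close> is nonnegative, as \<open>det\<close> requires.\<close>
      have "0 \<le> (\<Sum>n\<in>UNIV. (r n + \<gamma> n) * real (\<alpha>0 n))"
        using s by (intro sum_nonneg mult_nonneg_nonneg) (auto simp: less_imp_le)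
      then have Tb: "0 \<le> T - b \<beta>"
        using A[of \<alpha>0] \<alpha>0 by simp
      have "(\<Sum>\<alpha>\<in>?A \<beta>. work_profile \<gamma> (\<alpha>, \<beta>))
          = (\<Sum>\<alpha>\<in>?A \<beta>. exp (\<Sum>n\<in>UNIV. \<gamma> n / (r n + \<gamma> n) * ((r n + \<gamma> n) * real (\<alpha> n))))
            * (\<Prod>n\<in>UNIV. real (\<beta> n) + 1)"
        using s by (simp add: work_profile_def sum_distrib_right less_imp_neq[symmetric])
      also have "\<dots> \<le> C0 * exp (chi * (T - b \<beta>)) * (1 + (T - b \<beta>)) ^ ?m * (\<Prod>n\<in>UNIV. real (\<beta> n) + 1)"
        using A fin Tb by (intro mult_right_mono det prod_nonneg) auto
      also have "\<dots> \<le> C0 * exp (chi * (T - b \<beta>)) * (1 + T) ^ ?m * (\<Prod>n\<in>UNIV. real (\<beta> n) + 1)"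
        using C0 Tb b_nonneg[of \<beta>]
        by (intro mult_right_mono mult_left_mono power_mono prod_nonneg) auto
      also have "\<dots> = C0 * exp (chi * T) * (1 + T) ^ ?m
          * (exp (- (chi * b \<beta>)) * (\<Prod>n\<in>UNIV. real (\<beta> n) + 1))"
        by (simp add: right_diff_distrib exp_diff exp_minus field_simps)
      also have "\<dots> \<le> C0 * exp (chi * T) * (1 + T) ^ ?m * (\<Prod>n\<in>UNIV. \<omega> n (\<beta> n))"
        using C0 T exp_b by (intro mult_left_mono) auto
      finally show "(\<Sum>\<alpha>\<in>?A \<beta>. work_profile \<gamma> (\<alpha>, \<beta>))
          \<le> C0 * exp (chi * T) * (1 + T) ^ ?m * (\<Prod>n\<in>UNIV. \<omega> n (\<beta> n))" .
    qed
    also have "\<dots> = C0 * exp (chi * T) * (1 + T) ^ ?m * (\<Sum>\<beta>\<in>snd ` F. \<Prod>n\<in>UNIV. \<omega> n (\<beta> n))"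
      by (simp add: sum_distrib_left)
    also have "\<dots> \<le> C0 * exp (chi * T) * (1 + T) ^ ?m * (\<Prod>j\<in>UNIV. suminf (\<omega> j))"
      using C0 T F(1) \<omega>
      by (intro mult_left_mono sum_prod_box_le sum_le_suminf) (auto intro: less_imp_le)
    finally show "(\<Sum>x\<in>F. work_profile \<gamma> x)
        \<le> C0 * (\<Prod>j\<in>UNIV. suminf (\<omega> j)) * exp (chi * T) * (1 + T) ^ ?m"
      by (simp add: mult_ac)
  qed
qed

section \<open>The level as a function of the work budget\<close>

text \<open>The level of the theorem for \<open>m = n_chi - 1\<close>, taken as a natural number so
  that it can serve as the exponent of ordinary powers.\<close>

definition level :: "real \<Rightarrow> nat \<Rightarrow> real \<Rightarrow> real \<Rightarrow> real" where
  "level chi m C W = 1 / chi * (ln (W / C) - real m * ln (1 / chi * ln (W / C)))"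

text \<open>The level solves \<open>C * exp (chi * L) * l ^ m = W\<close>, an explicit substitute
  for the equation with \<open>1 + L\<close> in place of \<open>l\<close>. The condition on
  \<open>W\<close> amounts to \<open>1 \<le> l\<close>, so the subtracted logarithm is
  nonnegative.\<close>

lemma level_bounds:
  fixes chi C W :: real and m
  assumes "0 < chi" "0 < C" "C * exp chi \<le> W"
  defines "l \<equiv> 1 / chi * ln (W / C)"
  shows "1 \<le> l" "level chi m C W \<le> l" "exp (chi * level chi m C W) = W / C / l ^ m"
proof -
  have "exp chi \<le> W / C"
    using assms by (simp add: field_simps)
  moreover have WC: "0 < W / C"
    using calculation exp_gt_zero[of chi] by linarith
  ultimately have "chi \<le> ln (W / C)"
    by (simp add: ln_ge_iff)
  then show l: "1 \<le> l"
    using assms(1) by (simp add: l_def)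
  have eq: "chi * level chi m C W = ln (W / C) - real m * ln l"
    using assms(1) by (simp add: level_def l_def)
  have "chi * level chi m C W \<le> chi * l"
    unfolding eq using l assms(1) by (simp add: l_def)
  then show "level chi m C W \<le> l"
    using assms(1) by simp
  show "exp (chi * level chi m C W) = W / C / l ^ m"
    unfolding eq using WC l by (simp add: exp_diff exp_of_nat_mult)
qed

text \<open>Since \<open>chi - 1 = - (chi * \<mu>)\<close>, the exponential is the power
  \<open>- \<mu>\<close> of \<open>W / C / l ^ m\<close>. This yields
  \<open>l powr (\<mu> * m)\<close>, and \<open>1 + L \<le> 2 * l\<close> supplies \<open>m\<close>
  further powers, whence the exponent \<open>(\<mu> + 1) * m\<close>.\<close>

lemma level_error_le:
  fixes chi C W :: real
  assumes chi: "0 < chi" "chi < 1" and C: "0 < C" and W: "C * exp chi \<le> W" "exp 1 \<le> W"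
    and L: "0 \<le> level chi m C W"
  defines "\<mu> \<equiv> (1 - chi) / chi"
  shows "exp ((chi - 1) * level chi m C W) * (1 + level chi m C W) ^ m
    \<le> C powr \<mu> * 2 ^ m * ((1 + \<bar>ln C\<bar>) / chi) powr ((\<mu> + 1) * real m)
      * (W powr (- \<mu>) * ln W powr ((\<mu> + 1) * real m))"
proof -
  define l where "l = 1 / chi * ln (W / C)"
  have l: "1 \<le> l" "level chi m C W \<le> l" "exp (chi * level chi m C W) = W / C / l ^ m"
    using level_bounds(1)[OF chi(1) C W(1)] level_bounds(2,3)[OF chi(1) C W(1), of m] by (simp_all add: l_def)
  have W0: "0 < W" "1 \<le> ln W"
    using W(2) exp_gt_zero[of "1::real"] by (linarith, subst ln_ge_iff) linarith+
  have \<mu>: "0 \<le> \<mu>" "(chi - 1) = chi * (- \<mu>)"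
    using chi by (simp_all add: \<mu>_def)
  have "exp ((chi - 1) * level chi m C W) = exp (chi * level chi m C W) powr (- \<mu>)"
    by (simp add: \<mu>(2) powr_def mult_ac)
  also have "\<dots> = W powr (- \<mu>) * C powr \<mu> * l powr (\<mu> * real m)"
    using l(1) W0 C
    by (simp add: l(3) powr_divide powr_minus powr_powr powr_mult powr_realpow[symmetric] field_simps)
  finally have "exp ((chi - 1) * level chi m C W) * (1 + level chi m C W) ^ m
      = W powr (- \<mu>) * C powr \<mu> * l powr (\<mu> * real m) * (1 + level chi m C W) ^ m"
    by simp
  also have "\<dots> \<le> W powr (- \<mu>) * C powr \<mu> * l powr (\<mu> * real m) * (2 * l) ^ m"
    using l L by (intro mult_left_mono power_mono) auto
  also have "\<dots> = W powr (- \<mu>) * C powr \<mu> * 2 ^ m * l powr ((\<mu> + 1) * real m)"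
    using l(1) by (simp add: power_mult_distrib powr_realpow[symmetric] powr_add distrib_right)
  also have "\<dots> \<le> W powr (- \<mu>) * C powr \<mu> * 2 ^ m * ((1 + \<bar>ln C\<bar>) / chi * ln W) powr ((\<mu> + 1) * real m)"
  \<comment> \<open>The condition \<open>exp 1 \<le> W\<close> gives \<open>1 \<le> ln W\<close>, so
    the additive constant \<open>\<bar>ln C\<bar>\<close> can be absorbed into a multiple of
    \<open>ln W\<close>.\<close>
  proof (intro mult_left_mono powr_mono2)
    have "ln (W / C) \<le> ln W + \<bar>ln C\<bar>"
      using W0 C by (simp add: ln_div)
    also have "\<dots> \<le> (1 + \<bar>ln C\<bar>) * ln W"
      using W0 by (simp add: distrib_right mult_le_cancel_left1)
    finally show "l \<le> (1 + \<bar>ln C\<bar>) / chi * ln W"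
      using chi by (simp add: l_def divide_right_mono)
  qed (use l \<mu> in auto)
  also have "\<dots> = C powr \<mu> * 2 ^ m * ((1 + \<bar>ln C\<bar>) / chi) powr ((\<mu> + 1) * real m)
      * (W powr (- \<mu>) * ln W powr ((\<mu> + 1) * real m))"
    using chi W0 by (subst powr_mult) auto
  finally show ?thesis .
qed

lemma eventually_level_nonneg:
  assumes "0 < chi" "0 < C"
  shows "\<forall>\<^sub>F W in at_top. 0 \<le> level chi m C W"
  unfolding level_def using assms by real_asymp

text \<open>The limit superior lives in the extended reals, so finiteness means excluding both
  infinities.\<close>

lemma Limsup_eq_real:
  fixes f :: "'a \<Rightarrow> real"
  assumes "F \<noteq> bot" "\<forall>\<^sub>F x in F. a \<le> f x" "\<forall>\<^sub>F x in F. f x \<le> b"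
  shows "\<exists>c. Limsup F (\<lambda>x. ereal (f x)) = ereal c"
proof -
  have "ereal a \<le> Limsup F (\<lambda>x. ereal (f x))"
    using assms by (intro le_Limsup) auto
  moreover have "Limsup F (\<lambda>x. ereal (f x)) \<le> ereal b"
    using assms by (intro Limsup_bounded) auto
  ultimately show ?thesis
    by (cases "Limsup F (\<lambda>x. ereal (f x))") auto
qed

section \<open>The complexity estimate\<close>

theorem theorem4p2:
  fixes \<Gamma> :: "'n::finite \<Rightarrow> real set"
    and B :: "'u::{real_inner, banach, second_countable_topology} \<Rightarrow>\<^sub>L
              ('v::{real_inner, banach, second_countable_topology} \<Rightarrow>\<^sub>L real)"
    and u :: 'u
    and m :: "nat \<Rightarrow> nat"
    and h :: "'d::finite \<Rightarrow> nat \<Rightarrow> real" and h0 :: real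
    and uab :: "('d \<Rightarrow> nat) \<Rightarrow> ('n \<Rightarrow> nat) \<Rightarrow> 'u"
    and \<Delta>W \<Delta>W_det \<Delta>W_stoc :: "('d \<Rightarrow> nat) \<Rightarrow> ('n \<Rightarrow> nat) \<Rightarrow> real"
    and C_work C_error :: real
    and C_work_det C_error_det :: "('n \<Rightarrow> nat) \<Rightarrow> real"
    and C_work_stoc C_error_stoc :: "('d \<Rightarrow> nat) \<Rightarrow> real"
    and \<gamma>t rt \<gamma> r \<Theta> :: "'d \<Rightarrow> real" and gt :: "'n \<Rightarrow> real"
    and \<mu> chi :: real and n_chi :: nat
  assumes setting: "discretized_ocp \<Gamma> B \<phi> \<nu> e S p q F dF u pa \<sigma> m x w h US VS uab"
    and m: "\<And>b. 1 \<le> b \<Longrightarrow> m b = b"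
    and h: "0 < h0" "\<And>n a. h n a = h0 * 2 powr (- real a)"
    and work_nonneg:
      "\<And>\<alpha> \<beta>. 0 \<le> \<Delta>W \<alpha> \<beta>" "\<And>\<alpha> \<beta>. 0 \<le> \<Delta>W_det \<alpha> \<beta>" "\<And>\<alpha> \<beta>. 0 \<le> \<Delta>W_stoc \<alpha> \<beta>"
    and constants: "0 < C_work" "0 < C_error"
    and rates: "\<And>n. 0 < \<gamma>t n" "\<And>n. 0 < rt n" "\<And>n. 0 < gt n"
    and work: "\<And>\<alpha> \<beta>. pos_index \<alpha> \<Longrightarrow> pos_index \<beta> \<Longrightarrow>
      \<Delta>W \<alpha> \<beta> \<le> C_work * (\<Prod>n\<in>UNIV. 2 powr (real (\<alpha> n) * \<gamma>t n)) * (\<Prod>n\<in>UNIV. (real (\<beta> n) + 1))"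
    and error: "\<And>\<alpha> \<beta>. pos_index \<alpha> \<Longrightarrow> pos_index \<beta> \<Longrightarrow>
      norm (surplus uab \<alpha> \<beta>) \<le> C_error * (\<Prod>n\<in>UNIV. 2 powr (- (real (\<alpha> n) * rt n)))
        * (\<Prod>n\<in>UNIV. exp (- (gt n * (real (\<beta> n) + 1))))"
    and work_det: "\<And>\<alpha> \<beta>. pos_index \<alpha> \<Longrightarrow> pos_index \<beta> \<Longrightarrow>
      \<Delta>W_det \<alpha> \<beta> \<le> C_work_det \<beta> * (\<Prod>n\<in>UNIV. 2 powr (real (\<alpha> n) * \<gamma>t n))"
    and error_det: "\<And>\<alpha> \<beta>. pos_index \<alpha> \<Longrightarrow> pos_index \<beta> \<Longrightarrow>
      norm (surplus_det uab \<alpha> \<beta>) \<le> C_error_det \<beta> * (\<Prod>n\<in>UNIV. 2 powr (- (real (\<alpha> n) * rt n)))"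
    and work_stoc: "\<And>\<alpha> \<beta>. pos_index \<alpha> \<Longrightarrow> pos_index \<beta> \<Longrightarrow>
      \<Delta>W_stoc \<alpha> \<beta> \<le> C_work_stoc \<alpha> * (\<Prod>n\<in>UNIV. (real (\<beta> n) + 1))"
    and error_stoc: "\<And>\<alpha> \<beta>. pos_index \<alpha> \<Longrightarrow> pos_index \<beta> \<Longrightarrow>
      norm (surplus_stoc uab \<alpha> \<beta>)
        \<le> C_error_stoc \<alpha> * (\<Prod>n\<in>UNIV. exp (- (gt n * (real (\<beta> n) + 1))))"
    and r: "\<And>n. r n = ln 2 * rt n"
    and \<gamma>: "\<And>n. \<gamma> n = ln 2 * \<gamma>t n"
    and \<Theta>: "\<And>n. \<Theta> n = \<gamma> n / (r n + \<gamma> n)"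
    and \<mu>: "\<mu> = Min (range (\<lambda>n. r n / \<gamma> n))"
    and chi: "chi = Max (range \<Theta>)"
    and n_chi: "n_chi = card {n. \<Theta> n = chi}"
  shows "\<exists>C_W>0.
    let L = (\<lambda>W. 1 / chi * (ln (W / C_W) - (real n_chi - 1) * ln (1 / chi * ln (W / C_W)))) in
      (\<forall>W. C_W * exp chi \<le> W \<longrightarrow> combination_work \<Delta>W (index_set r \<gamma> gt (L W)) \<le> W) \<and>
      (\<exists>C :: real. Limsup at_top (\<lambda>W :: real.
          ereal (combination_error u uab (index_set r \<gamma> gt (L W))
            / (W powr (- \<mu>) * (ln W) powr ((\<mu> + 1) * (real n_chi - 1))))) = ereal C)"
proof -
  have pos: "0 < r n" "0 < \<gamma> n" "0 < gt n'" for n n'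
    using rates by (simp_all add: r \<gamma>)
  have s: "0 < r n + \<gamma> n" for n
    using pos by (simp add: add_pos_pos)
  have zero: "uab \<alpha> \<beta> = 0" if "\<not> (pos_index \<alpha> \<and> pos_index \<beta>)" for \<alpha> \<beta>
    using discretized_ocp.uab_zero[OF setting] that by blast
  have lim: "((\<lambda>(\<alpha>, \<beta>). uab \<alpha> \<beta>) \<longlongrightarrow> u) (at_top \<times>\<^sub>F at_top)"
    using discretized_ocp.convergence[OF setting] .
  \<comment> \<open>The maximum is attained, so \<open>n_chi\<close> is at least 1 and the natural
    subtraction agrees with the real one in the statement.\<close>
  define k where "k = n_chi - 1"
  have "chi \<in> range \<Theta>"
    unfolding chi by (rule Max_in) auto
  then obtain n0 where n0: "\<Theta> n0 = chi" by auto
  have \<Theta>_le: "\<Theta> n \<le> chi" for n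
    unfolding chi by (rule Max_ge) auto
  have chi_bounds: "0 < chi" "chi < 1"
    using pos s[of n0] by (auto simp: n0[symmetric] \<Theta>)
  have "1 \<le> n_chi"
    using n0 by (auto simp: n_chi Suc_le_eq card_gt_0_iff)
  then have k: "real n_chi - 1 = real k"
    by (simp add: k_def of_nat_diff)
  \<comment> \<open>The ratio \<open>r n / \<gamma> n\<close> equals
    \<open>1 / \<Theta> n - 1\<close>, which decreases in \<open>\<Theta> n\<close>; its minimum is
    reached where \<open>\<Theta> n\<close> is maximal.\<close>
  have \<mu>_eq: "\<mu> = (1 - chi) / chi"
    unfolding \<mu>
  proof (rule Min_eqI)
    have ratio: "r n / \<gamma> n = 1 / \<Theta> n - 1" for n
      using pos(1,2)[of n] s[of n] by (simp add: \<Theta> field_simps)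
    have \<Theta>_pos: "0 < \<Theta> n" for n
      using pos s by (simp add: \<Theta>)
    have *: "(1 - chi) / chi = 1 / chi - 1"
      using chi_bounds by (simp add: field_simps)
    show "(1 - chi) / chi \<in> range (\<lambda>n. r n / \<gamma> n)"
      using n0 ratio * by auto
    fix y assume "y \<in> range (\<lambda>n. r n / \<gamma> n)"
    then obtain n where "y = 1 / \<Theta> n - 1" using ratio by auto
    then show "(1 - chi) / chi \<le> y"
      using \<Theta>_le[of n] \<Theta>_pos[of n] by (simp add: * frac_le)
  qed simp
  obtain C1 where C1: "0 < C1" and work_sum:
    "\<And>T F. 0 \<le> T \<Longrightarrow> finite F \<Longrightarrow> F \<subseteq> (pos_indices :: (('d \<Rightarrow> nat) \<times> ('n \<Rightarrow> nat)) set) \<Longrightarrow>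
      (\<And>x. x \<in> F \<Longrightarrow> index_weight r \<gamma> gt x \<le> T) \<Longrightarrow>
      (\<Sum>x\<in>F. work_profile \<gamma> x) \<le> C1 * exp (chi * T) * (1 + T) ^ k"
    using sum_work_profile_le[of r \<gamma> gt chi n0] pos chi_bounds \<Theta>_le n0
    unfolding k_def n_chi \<Theta> by blast
  obtain C2 where C2: "0 < C2" and error_sum:
    "\<And>L F. 0 \<le> L \<Longrightarrow> finite F \<Longrightarrow> F \<subseteq> (pos_indices :: (('d \<Rightarrow> nat) \<times> ('n \<Rightarrow> nat)) set) \<Longrightarrow>
      (\<And>x. x \<in> F \<Longrightarrow> L < index_weight r \<gamma> gt x) \<Longrightarrow>
      (\<Sum>x\<in>F. exp (- index_weight r \<gamma> gt x) * work_profile \<gamma> x)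
        \<le> C2 * exp ((chi - 1) * L) * (1 + L) ^ k"
    using sum_tail_le[where S = pos_indices and X = "index_weight r \<gamma> gt" and t = "work_profile \<gamma>",
        OF chi_bounds(2) work_profile_nonneg C1 work_sum] by blast
  have work_le: "\<Delta>W \<alpha> \<beta> \<le> C_work * work_profile \<gamma> (\<alpha>, \<beta>)" if "(\<alpha>, \<beta>) \<in> pos_indices" for \<alpha> \<beta>
    using work[of \<alpha> \<beta>] that
    by (simp add: pos_indices_def work_profile_def \<gamma> powr_def exp_sum mult_ac)
  have error_le: "norm (surplus uab \<alpha> \<beta>)
      \<le> C_error * (exp (- index_weight r \<gamma> gt (\<alpha>, \<beta>)) * work_profile \<gamma> (\<alpha>, \<beta>))"
    if "(\<alpha>, \<beta>) \<in> pos_indices" for \<alpha> \<beta>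
    using error[of \<alpha> \<beta>] that unfolding exp_index_weight_mult_work_profile
    by (simp add: pos_indices_def r powr_def exp_sum sum_negf[symmetric] mult_ac)
  have fin: "finite (index_set r \<gamma> gt L)" for L
    using pos by (intro finite_index_set) auto
  \<comment> \<open>The constants of the work bound and of \<open>work_sum\<close>, with
    \<open>2 ^ k\<close> paying for \<open>1 + L \<le> 2 * l\<close>.\<close>
  define C_W where "C_W = C_work * C1 * 2 ^ k"
  have C_W: "0 < C_W"
    using constants C1 by (simp add: C_W_def)
  have work_bound: "combination_work \<Delta>W (index_set r \<gamma> gt (level chi k C_W W)) \<le> W"
    if W: "C_W * exp chi \<le> W" for W
  proof -
    define L where "L = level chi k C_W W"
    define l where "l = 1 / chi * ln (W / C_W)"
    have l: "1 \<le> l" "L \<le> l" "exp (chi * L) = W / C_W / l ^ k"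
      using level_bounds(1)[OF chi_bounds(1) C_W W] level_bounds(2,3)[OF chi_bounds(1) C_W W, of k] by (simp_all add: l_def L_def)
    have "0 < W"
      using W C_W by (meson exp_gt_zero less_le_trans mult_pos_pos)
    have "combination_work \<Delta>W (index_set r \<gamma> gt L) \<le> W"
    proof (cases "0 \<le> L")
      \<comment> \<open>The level can become negative for moderate budgets. The weight is positive,
        so the index set is then empty and costs nothing.\<close>
      case False
      then have "index_set r \<gamma> gt L = {}"
        using less_trans[of L 0, OF _ index_weight_pos[of r \<gamma> gt, OF pos]]
        by (auto simp: index_set_eq not_le)
      then show ?thesis
        using \<open>0 < W\<close> by (simp add: combination_work_def)
    next
      case True
      have "combination_work \<Delta>W (index_set r \<gamma> gt L) \<le> (\<Sum>x\<in>index_set r \<gamma> gt L. C_work * work_profile \<gamma> x)"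
        unfolding combination_work_def using work_le by (intro sum_mono) (auto simp: index_set_eq)
      also have "\<dots> = C_work * (\<Sum>x\<in>index_set r \<gamma> gt L. work_profile \<gamma> x)"
        by (simp add: sum_distrib_left)
      also have "\<dots> \<le> C_work * (C1 * exp (chi * L) * (1 + L) ^ k)"
        using True constants fin by (intro mult_left_mono work_sum) (auto simp: index_set_eq)
      also have "\<dots> \<le> C_work * (C1 * exp (chi * L) * (2 * l) ^ k)"
        using True constants C1 C_W l \<open>0 < W\<close> by (intro mult_left_mono power_mono) auto
      \<comment> \<open>By the equation for \<open>exp (chi * L)\<close>, the powers of
        \<open>l\<close> cancel and the constants combine to \<open>C_W\<close>, so the bound is
        exactly the budget.\<close>
      also have "\<dots> = W"
        using l constants C1 by (simp add: C_W_def power_mult_distrib)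
      finally show ?thesis .
    qed
    then show ?thesis by (simp add: L_def)
  qed
  have error_bound: "combination_error u uab (index_set r \<gamma> gt L)
      \<le> C_error * (C2 * exp ((chi - 1) * L) * (1 + L) ^ k)" if L: "0 \<le> L" for L
  proof (rule combination_error_le[OF zero lim fin])
    show "index_set r \<gamma> gt L \<subseteq> pos_indices"
      by (auto simp: index_set_eq)
    fix F :: "(('d \<Rightarrow> nat) \<times> ('n \<Rightarrow> nat)) set"
    assume F: "finite F" "F \<subseteq> pos_indices - index_set r \<gamma> gt L"
    have "(\<Sum>(\<alpha>, \<beta>)\<in>F. norm (surplus uab \<alpha> \<beta>))
        \<le> (\<Sum>x\<in>F. C_error * (exp (- index_weight r \<gamma> gt x) * work_profile \<gamma> x))"
      using error_le F(2) by (intro sum_mono) auto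
    also have "\<dots> = C_error * (\<Sum>x\<in>F. exp (- index_weight r \<gamma> gt x) * work_profile \<gamma> x)"
      by (simp add: sum_distrib_left)
    also have "\<dots> \<le> C_error * (C2 * exp ((chi - 1) * L) * (1 + L) ^ k)"
      using constants F L by (intro mult_left_mono error_sum) (auto simp: index_set_eq)
    finally show "(\<Sum>(\<alpha>, \<beta>)\<in>F. norm (surplus uab \<alpha> \<beta>))
        \<le> C_error * (C2 * exp ((chi - 1) * L) * (1 + L) ^ k)" .
  qed
  \<comment> \<open>The constants of \<open>error_bound\<close> times those of
    \<open>level_error_le\<close>.\<close>
  define D where "D = C_error * C2 * (C_W powr \<mu> * 2 ^ k * ((1 + \<bar>ln C_W\<bar>) / chi) powr ((\<mu> + 1) * real k))"
  let ?f = "\<lambda>W. combination_error u uab (index_set r \<gamma> gt (level chi k C_W W))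
    / (W powr (- \<mu>) * ln W powr ((\<mu> + 1) * real k))"
  have upper: "\<forall>\<^sub>F W in at_top. ?f W \<le> D"
    using eventually_level_nonneg[OF chi_bounds(1) C_W, of k] eventually_ge_at_top[of "C_W * exp chi"]
      eventually_ge_at_top[of "exp 1"]
  proof eventually_elim
    case (elim W)
    have "1 < W"
      using elim(3) exp_gt_one[of "1::real"] by linarith
    then have den: "0 < W powr (- \<mu>) * ln W powr ((\<mu> + 1) * real k)"
      by simp
    let ?L = "level chi k C_W W"
    have "combination_error u uab (index_set r \<gamma> gt ?L)
        \<le> C_error * C2 * (exp ((chi - 1) * ?L) * (1 + ?L) ^ k)"
      using error_bound[OF elim(1)] by (simp add: mult_ac)
    also have "\<dots> \<le> D * (W powr (- \<mu>) * ln W powr ((\<mu> + 1) * real k))"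
      using mult_left_mono[OF level_error_le[OF chi_bounds C_W elim(2,3,1)], of "C_error * C2"]
        constants C2 unfolding D_def \<mu>_eq by (simp add: mult_ac)
    finally show ?case
      using den by (simp add: pos_divide_le_eq)
  qed
  have lower: "\<forall>\<^sub>F W in at_top. 0 \<le> ?f W"
    by (auto simp: combination_error_def)
  have "\<exists>C. Limsup at_top (\<lambda>W. ereal (?f W)) = ereal C"
    by (rule Limsup_eq_real[OF _ lower upper]) simp
  then show ?thesis
    using C_W work_bound unfolding k Let_def level_def by blast
qed

end
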